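(* Let $Z^{\diamondsuit}\colon\mathcal{H}^0\to\mathbb{Q}^{\mathbb{N}}$ be the $\mathbb{Z}$-linear map sending a word to the corresponding multiple zeta diamond value, let $\tau$ be the anti-automorphism of $\mathcal{H}=\mathbb{Z}\langle x,y\rangle$ interchanging $x$ and $y$, and let $\star$ be the product on $\mathcal{H}^{2,3}=\mathbb{Z}\langle z_2,z_3\rangle$ (all as defined in the context). Then for all $w_1,w_2\in\mathcal{H}^{2,3}$, \[ Z^{\diamondsuit}(w_1\tau(w_2))=Z^{\diamondsuit}(w_1\star w_2). \]
   Context: **Algebras.** $\mathcal{H}=\mathbb{Z}\langle x,y\rangle$ is the non-commutative polynomial ring over $\mathbb{Z}$ in two variables $x,y$. For each positive integer $k$ put $z_k=yx^{k-1}$. Define subrings $\mathcal{H}^{2,3}=\mathbb{Z}\langle z_2,z_3\rangle$ and $\mathcal{H}^0=\mathbb{Z}+y\mathcal{H}x$ of $\mathcal{H}$. A word in $\mathcal{H}^{2,3}$ is a (possibly empty) monomial in $z_2,z_3$. **The anti-automorphism $\tau$.** $\tau$ is the anti-automorphism of $\mathcal{H}$ (i.e. $\tau(uv)=\tau(v)\tau(u)$) with $\tau(x)=y$, $\tau(y)=x$. **The product $\star$.** $\star$ is the $\mathbb{Z}$-bilinear product on $\mathcal{H}^{2,3}$ defined inductively, for words $w,w'$ in $\mathcal{H}^{2,3}$, by - $w\star 1=1\star w=w$; - $wz_2\star w'=w\star w'z_2=(w\star w')z_2$; - $wz_3\star w'z_3=(w\star w'z_3)z_3+(wz_3\star w')z_3+(w\star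 w')z_2^3$. **Multiple zeta diamond values.** $\mathbb{N}$ is the set of positive integers. Every tuple $(k_1,\dots,k_r)$ of positive integers with $r\geq1$ and $k_r\geq2$ can be written uniquely as $(\{1\}^{a_1-1},b_1+1,\dots,\{1\}^{a_s-1},b_s+1)$ with $s\geq 1$ and positive integers $a_1,\dots,a_s,b_1,\dots,b_s$, where $\{1\}^n$ denotes $1$ repeated $n$ times; equivalently, $z_{k_1}\cdots z_{k_r}=y^{a_1}x^{b_1}\cdots y^{a_s}x^{b_s}$. For a positive integer $N$ put \[ \zeta^{\diamondsuit}_N(k_1,\dots,k_r)=\sum\ \prod_{i=1}^{s}\frac{1}{(N-n_{i,1})\cdots(N-n_{i,a_i})}\cdot\frac{1}{m_{i,1}\cdots m_{i,b_i}}\in\mathbb{Q}, \] where the sum runs over all integers $n_{i,j}$ ($1\le i\le s$, $1\le j\le a_i$) and $m_{i,j}$ ($1\le i\le s$, $1\le j\le b_i$) with $0<n_{i,1}\leq\cdots\leq n_{i,a_i}\leq m_{i,1}\leq\cdots\leq m_{i,b_i}<N$ for $1\le i\le s$ and $m_{i,b_i}<n_{i+1,1}$ for $1\le i\le s-1$. The multiple zeta diamond value is the sequence $\zeta^{\diamondsuit}(k_1,\dots,k_r)=(\zeta^{\diamondsuit}_N(k_1,\dots,k_r))_{N\in\mathbb{N}}\in\mathbb{Q}^{\mathbb{N}}$. $Z^{\diamondsuit}\colon\mathcal{H}^0\to\mathbb{Q}^{\mathbb{N}}$ is the $\mathbb{Z}$-linear map with $Z^{\diamondsuit}(1)=1$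 (the constant sequence $1$) and $Z^{\diamondsuit}(z_{k_1}\cdots z_{k_r})=\zeta^{\diamondsuit}(k_1,\dots,k_r)$ for $k_r\ge2$. *)

theory Defs
  imports Complex_Main "HOL-Library.Poly_Mapping"
begin

section \<open>The ring of non-commutative polynomials in two variables\<close>

text \<open>
  Words form a monoid under concatenation. With this instance the library's convolution product
  on finitely supported functions makes \<^typ>\<open>'a list \<Rightarrow>\<^sub>0 int\<close> the free associative unital ring
  on \<^typ>\<open>'a\<close>.
\<close>

instantiation list :: (type) monoid_add
begin

definition zero_list :: "'a list" where "zero_list = []"

definition plus_list :: "'a list \<Rightarrow> 'a list \<Rightarrow> 'a list" where "plus_list = (@)"

instance by standard (auto simp: zero_list_def plus_list_def)

end

datatype letter = X | Y

type_synonym ncpoly = "letter list \<Rightarrow>\<^sub>0 int"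

abbreviation word :: "letter list \<Rightarrow> ncpoly" where "word \<equiv> frag_of"

definition gen_x :: ncpoly where "gen_x = word [X]"
definition gen_y :: ncpoly where "gen_y = word [Y]"

definition gen_z :: "nat \<Rightarrow> ncpoly" where "gen_z k = gen_y * gen_x ^ (k - 1)"

inductive_set H23 :: "ncpoly set" where
  one: "1 \<in> H23"
| z2: "gen_z 2 \<in> H23"
| z3: "gen_z 3 \<in> H23"
| diff: "p \<in> H23 \<Longrightarrow> q \<in> H23 \<Longrightarrow> p - q \<in> H23"
| mult: "p \<in> H23 \<Longrightarrow> q \<in> H23 \<Longrightarrow> p * q \<in> H23"

definition H0 :: "ncpoly set" where
  "H0 = {of_int c + gen_y * h * gen_x | c h. True}"

lemma word_mult: "word u * word v = word (u @ v)"
  by (simp add: mult_single plus_list_def)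

lemma word_Nil: "word [] = 1"
  by (simp add: zero_list_def[symmetric])

lemma x_power: "gen_x ^ n = word (replicate n X)"
  by (induction n) (simp_all add: word_Nil gen_x_def word_mult)

lemma z_eq_word: "gen_z k = word (Y # replicate (k - 1) X)"
  by (simp add: gen_z_def x_power gen_y_def word_mult)

lemma z2_eq: "gen_z 2 = word [Y, X]"
  by (simp add: z_eq_word)

lemma z3_eq: "gen_z 3 = word [Y, X, X]"
  by (simp add: z_eq_word numeral_eq_Suc)


lemma ncpoly_induct [case_names zero word diff]:
  fixes p :: ncpoly
  assumes "P 0" "\<And>u. P (word u)" "\<And>p q. P p \<Longrightarrow> P q \<Longrightarrow> P (p - q)"
  shows "P p"
  by (rule frag_induction[where S = UNIV]) (use assms in auto)


section \<open>The anti-automorphism\<close>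

fun swap_letter :: "letter \<Rightarrow> letter" where
  "swap_letter X = Y"
| "swap_letter Y = X"

text \<open>\<^const>\<open>frag_extend\<close> is the extension of a map on words to an additive map.\<close>

definition tau :: "ncpoly \<Rightarrow> ncpoly" where
  "tau = frag_extend (\<lambda>u. word (map swap_letter (rev u)))"

lemma swap_letter_involution: "swap_letter \<circ> swap_letter = id"
  by (rule ext, rename_tac l, case_tac l) auto

lemma tau_word: "tau (word u) = word (map swap_letter (rev u))"
  by (simp add: tau_def)

lemma tau_x: "tau gen_x = gen_y"
  by (simp add: gen_x_def gen_y_def tau_word)

lemma tau_y: "tau gen_y = gen_x"
  by (simp add: gen_x_def gen_y_def tau_word)

lemma tau_1: "tau 1 = 1"
  using tau_word[of "[]"] by (simp add: word_Nil)

lemma tau_add: "tau (p + q) = tau p + tau q"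
  by (simp add: tau_def frag_extend_add)

lemma tau_diff: "tau (p - q) = tau p - tau q"
  by (simp add: tau_def frag_extend_diff)

lemma tau_0: "tau 0 = 0"
  by (simp add: tau_def)

lemma tau_mult: "tau (p * q) = tau q * tau p"
proof (induction p rule: ncpoly_induct)
  case (word u)
  show ?case
  proof (induction q rule: ncpoly_induct)
    case (word v)
    show ?case by (simp add: word_mult tau_word)
  qed (auto simp: tau_0 tau_diff algebra_simps)
qed (auto simp: tau_0 tau_diff algebra_simps)

lemma tau_involution: "tau (tau p) = p"
  by (induction p rule: ncpoly_induct)
     (auto simp: tau_0 tau_diff tau_word rev_map swap_letter_involution)


section \<open>The star product\<close>

text \<open>
  The defining recursion strips factors \<open>z\<^sub>2\<close> and \<open>z\<^sub>3\<close> from the right end of the words, so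
  \<open>star_rev\<close> takes its arguments reversed: \<open>X # Y # u\<close> and \<open>X # X # Y # u\<close> are the reversals of
  words ending in \<open>z\<^sub>2\<close> and \<open>z\<^sub>3\<close>. Values on words outside \<open>H23\<close> have no meaning. The lemmas
  \<open>star_1_left\<close>, \<open>star_1_right\<close>, \<open>star_z2_left\<close>, \<open>star_z2_right\<close> and \<open>star_z3_z3\<close> below are the
  usual inductive characterization, without reversal.
\<close>

fun star_rev :: "letter list \<Rightarrow> letter list \<Rightarrow> ncpoly" where
  "star_rev [] v = word (rev v)"
| "star_rev u [] = word (rev u)"
| "star_rev (X # Y # u) v = star_rev u v * gen_z 2"
| "star_rev u (X # Y # v) = star_rev u v * gen_z 2"
| "star_rev (X # X # Y # u) (X # X # Y # v) =
     star_rev u (X # X # Y # v) * gen_z 3 + star_rev (X # X # Y # u) v * gen_z 3 + star_rev u v * gen_z 2 ^ 3"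
| "star_rev _ _ = 0"

definition star :: "ncpoly \<Rightarrow> ncpoly \<Rightarrow> ncpoly" (infixl "\<star>" 70) where
  "p \<star> q = frag_extend (\<lambda>u. frag_extend (\<lambda>v. star_rev (rev u) (rev v)) q) p"

lemma star_add_left: "(p + p') \<star> q = p \<star> q + p' \<star> q"
  by (simp add: star_def frag_extend_add)

lemma star_diff_left: "(p - p') \<star> q = p \<star> q - p' \<star> q"
  by (simp add: star_def frag_extend_diff)

lemma star_add_right: "p \<star> (q + q') = p \<star> q + p \<star> q'"
  unfolding star_def frag_extend_add
  by (simp add: frag_extend_def frag_cmul_distrib2 sum.distrib)

lemma star_0_left: "0 \<star> q = 0"
  by (simp add: star_def)

lemma star_0_right: "p \<star> 0 = 0"
  by (simp add: star_def frag_extend_eq_0)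

lemma star_diff_right: "p \<star> (q - q') = p \<star> q - p \<star> q'"
  using star_add_right[of p "q - q'" q'] by simp

lemma star_word: "word u \<star> word v = star_rev (rev u) (rev v)"
  by (simp add: star_def)

lemma star_1_left: "1 \<star> q = q"
proof (induction q rule: ncpoly_induct)
  case (word v)
  show ?case by (simp add: word_Nil[symmetric] star_word)
qed (auto simp: star_0_right star_diff_right)

lemma star_rev_Nil: "star_rev u [] = word (rev u)"
  by (cases u) auto

lemma star_1_right: "p \<star> 1 = p"
proof (induction p rule: ncpoly_induct)
  case (word v)
  show ?case by (simp add: word_Nil[symmetric] star_word star_rev_Nil)
qed (auto simp: star_0_left star_diff_left)

inductive_set words23 :: "letter list set" where
  Nil: "[] \<in> words23"
| snoc_z2: "u \<in> words23 \<Longrightarrow> u @ [Y, X] \<in> words23"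
| snoc_z3: "u \<in> words23 \<Longrightarrow> u @ [Y, X, X] \<in> words23"

lemma star_rev_z2_left: "star_rev (X # Y # u) v = star_rev u v * gen_z 2"
  by (cases v) (simp_all add: star_rev_Nil z2_eq word_mult)

lemma star_rev_z2_right:
  "u \<in> words23 \<Longrightarrow> star_rev (rev u) (X # Y # v) = star_rev (rev u) v * gen_z 2"
  by (induction u rule: words23.induct)
     (simp_all add: z2_eq word_mult star_rev_z2_left)

lemma star_z2_left: "(word u * gen_z 2) \<star> word v = (word u \<star> word v) * gen_z 2"
  using star_rev_z2_left[of "rev u" "rev v"] by (simp add: star_word z2_eq word_mult)

lemma star_z2_right:
  "u \<in> words23 \<Longrightarrow> word u \<star> (word v * gen_z 2) = (word u \<star> word v) * gen_z 2"
  using star_rev_z2_right[of u "rev v"] by (simp add: star_word z2_eq word_mult)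

lemma star_z3_z3:
  "(word u * gen_z 3) \<star> (word v * gen_z 3) =
     (word u \<star> (word v * gen_z 3)) * gen_z 3 + ((word u * gen_z 3) \<star> word v) * gen_z 3
     + (word u \<star> word v) * gen_z 2 ^ 3"
  by (simp add: star_word z3_eq word_mult)


section \<open>Multiple zeta diamond values\<close>

definition admissible :: "nat list \<Rightarrow> bool" where
  "admissible ks \<longleftrightarrow> ks \<noteq> [] \<and> (\<forall>k\<in>set ks. k \<ge> 1) \<and> last ks \<ge> 2"

text \<open>
  \<open>index_of_blocks [(a\<^sub>1, b\<^sub>1), \<dots>, (a\<^sub>s, b\<^sub>s)]\<close> is the index
  \<open>({1}\<^bsup>a\<^sub>1-1\<^esup>, b\<^sub>1 + 1, \<dots>, {1}\<^bsup>a\<^sub>s-1\<^esup>, b\<^sub>s + 1)\<close>.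
\<close>

definition index_of_blocks :: "(nat \<times> nat) list \<Rightarrow> nat list" where
  "index_of_blocks bs = concat (map (\<lambda>(a, b). replicate (a - 1) 1 @ [b + 1]) bs)"

definition positive_blocks :: "(nat \<times> nat) list \<Rightarrow> bool" where
  "positive_blocks bs \<longleftrightarrow> (\<forall>(a, b)\<in>set bs. a \<ge> 1 \<and> b \<ge> 1)"

definition blocks :: "nat list \<Rightarrow> (nat \<times> nat) list" where
  "blocks ks = (THE bs. positive_blocks bs \<and> index_of_blocks bs = ks)"

text \<open>
  The summation range: the \<open>i\<close>-th entry of a chain is the pair of the lists
  \<open>(n\<^bsub>i,1\<^esub>, \<dots>, n\<^bsub>i,a\<^sub>i\<^esub>)\<close> and \<open>(m\<^bsub>i,1\<^esub>, \<dots>, m\<^bsub>i,b\<^sub>i\<^esub>)\<close>.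
\<close>

definition diamond_chains :: "(nat \<times> nat) list \<Rightarrow> nat \<Rightarrow> (nat list \<times> nat list) list set" where
  "diamond_chains bs N =
     {c. list_all2
           (\<lambda>(ns, ms) (a, b). length ns = a \<and> length ms = b \<and> sorted (ns @ ms)
                              \<and> set (ns @ ms) \<subseteq> {0<..<N}) c bs
         \<and> (\<forall>i. Suc i < length c \<longrightarrow> last (snd (c ! i)) < hd (fst (c ! Suc i)))}"

definition zeta_diamond :: "nat list \<Rightarrow> nat \<Rightarrow> rat" where
  "zeta_diamond ks N =
     (\<Sum>c\<in>diamond_chains (blocks ks) N. \<Prod>(ns, ms)\<leftarrow>c.
        1 / (\<Prod>n\<leftarrow>ns. of_nat N - of_nat n) * (1 / (\<Prod>m\<leftarrow>ms. of_nat m)))"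

definition word_of_index :: "nat list \<Rightarrow> letter list" where
  "word_of_index ks = concat (map (\<lambda>k. Y # replicate (k - 1) X) ks)"

definition Zdiamond_word :: "letter list \<Rightarrow> nat \<Rightarrow> rat" where
  "Zdiamond_word u =
     (if u = [] then (\<lambda>N. 1)
      else zeta_diamond (THE ks. admissible ks \<and> word_of_index ks = u))"

text \<open>
  The additive extension; only its values on \<^const>\<open>H0\<close> are meaningful. Sequences are
  indexed by the positive integers, so the value at \<open>N = 0\<close> is to be ignored.
\<close>

definition Zdiamond :: "ncpoly \<Rightarrow> nat \<Rightarrow> rat" where
  "Zdiamond p N = (\<Sum>u\<in>Poly_Mapping.keys p. of_int (Poly_Mapping.lookup p u) * Zdiamond_word u N)"

lemma finite_diamond_chains: "finite (diamond_chains bs N)"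
proof -
  let ?S = "\<lambda>l. {ns :: nat list. set ns \<subseteq> {0<..<N} \<and> length ns = l}"
  let ?T = "\<Union>(a, b)\<in>set bs. ?S a \<times> ?S b"
  have "finite (?S l)" for l
    by (rule finite_lists_length_eq) simp
  then have "finite ?T" by auto
  then have "finite {c. set c \<subseteq> ?T \<and> length c = length bs}"
    by (rule finite_lists_length_eq)
  moreover have "diamond_chains bs N \<subseteq> {c. set c \<subseteq> ?T \<and> length c = length bs}"
  proof
    fix c
    assume "c \<in> diamond_chains bs N"
    then have c: "list_all2
           (\<lambda>(ns, ms) (a, b). length ns = a \<and> length ms = b \<and> sorted (ns @ ms)
                              \<and> set (ns @ ms) \<subseteq> {0<..<N}) c bs"
      by (simp add: diamond_chains_def)
    have "t \<in> ?T" if t: "t \<in> set c" for t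
    proof -
      from t obtain i where i: "i < length c" "t = c ! i" by (auto simp: in_set_conv_nth)
      with c have "i < length bs" by (simp add: list_all2_lengthD)
      then have "bs ! i \<in> set bs" by simp
      then show ?thesis
        using list_all2_nthD[OF c i(1)] i(2)
        by (intro UN_I[of "bs ! i"]) (auto split: prod.splits)
    qed
    with c show "c \<in> {c. set c \<subseteq> ?T \<and> length c = length bs}"
      by (auto dest: list_all2_lengthD)
  qed
  ultimately show ?thesis by (rule finite_subset[rotated])
qed

lemma index_of_blocks_Cons:
  "index_of_blocks ((a, b) # bs) = replicate (a - 1) 1 @ (b + 1) # index_of_blocks bs"
  by (simp add: index_of_blocks_def)

lemma replicate_1_append_inject:
  assumes "replicate m 1 @ (b + 1) # us = replicate n 1 @ (b' + 1) # vs"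
    and "b \<ge> (1 :: nat)" "b' \<ge> 1"
  shows "m = n \<and> b = b' \<and> us = vs"
  using assms(1)
proof (induction m arbitrary: n)
  case 0
  then show ?case using assms(2) by (cases n) auto
next
  case (Suc m)
  then show ?case using assms(3) by (cases n) auto
qed

lemma index_of_blocks_inject:
  assumes "index_of_blocks bs = index_of_blocks bs'" "positive_blocks bs" "positive_blocks bs'"
  shows "bs = bs'"
  using assms
proof (induction bs arbitrary: bs')
  case Nil
  then show ?case by (cases bs') (auto simp: index_of_blocks_def)
next
  case (Cons ab bs)
  obtain a b where ab: "ab = (a, b)" by force
  from Cons.prems(1) obtain a' b' cs where bs': "bs' = (a', b') # cs"
    by (cases bs') (auto simp: index_of_blocks_def ab)
  have pos: "a \<ge> 1" "b \<ge> 1" "a' \<ge> 1" "b' \<ge> 1" "positive_blocks bs" "positive_blocks cs"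
    using Cons.prems by (auto simp: positive_blocks_def ab bs')
  have "a - 1 = a' - 1 \<and> b = b' \<and> index_of_blocks bs = index_of_blocks cs"
    using Cons.prems(1) pos unfolding ab bs' index_of_blocks_Cons
    by (intro replicate_1_append_inject) auto
  then show ?case using Cons.IH[of cs] pos ab bs' by auto
qed

lemma index_of_blocks_exists:
  assumes "admissible ks"
  shows "\<exists>bs. positive_blocks bs \<and> index_of_blocks bs = ks"
  using assms
proof (induction ks)
  case Nil
  then show ?case by (simp add: admissible_def)
next
  case (Cons k ks)
  show ?case
  proof (cases "ks = []")
    case True
    then have "positive_blocks [(1, k - 1)] \<and> index_of_blocks [(1, k - 1)] = k # ks"
      using Cons.prems by (auto simp: positive_blocks_def index_of_blocks_def admissible_def)
    then show ?thesis by blast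
  next
    case False
    then have "admissible ks" using Cons.prems by (auto simp: admissible_def)
    then obtain bs where bs: "positive_blocks bs" "index_of_blocks bs = ks"
      using Cons.IH by blast
    show ?thesis
    proof (cases "k = 1")
      case True
      from False bs(2) obtain a b cs where cs: "bs = (a, b) # cs"
        by (cases bs) (auto simp: index_of_blocks_def)
      then have "a \<ge> 1" using bs(1) by (simp add: positive_blocks_def)
      then have "positive_blocks ((a + 1, b) # cs) \<and> index_of_blocks ((a + 1, b) # cs) = k # ks"
        using bs True cs
        by (cases a) (auto simp: positive_blocks_def index_of_blocks_def)
      then show ?thesis by blast
    next
      case False
      then have "positive_blocks ((1, k - 1) # bs) \<and> index_of_blocks ((1, k - 1) # bs) = k # ks"
        using bs Cons.prems by (auto simp: positive_blocks_def index_of_blocks_def admissible_def)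
      then show ?thesis by blast
    qed
  qed
qed

lemma blocks_index_of_blocks: "positive_blocks bs \<Longrightarrow> blocks (index_of_blocks bs) = bs"
  unfolding blocks_def by (rule the_equality) (auto intro: index_of_blocks_inject)

lemma blocks:
  assumes "admissible ks"
  shows "positive_blocks (blocks ks)" "index_of_blocks (blocks ks) = ks"
  using index_of_blocks_exists[OF assms] blocks_index_of_blocks by auto

lemma word_of_index_eq: "word (word_of_index ks) = prod_list (map gen_z ks)"
proof (induction ks)
  case Nil
  show ?case by (simp add: word_of_index_def word_Nil)
next
  case (Cons k ks)
  have "word (word_of_index (k # ks)) = gen_z k * word (word_of_index ks)"
    by (simp add: word_of_index_def z_eq_word word_mult)
  with Cons show ?case by simp
qed

lemma replicate_X_append_inject:
  assumes "replicate m X @ us = replicate n X @ vs" "us = [] \<or> hd us = Y" "vs = [] \<or> hd vs = Y"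
  shows "m = n \<and> us = vs"
  using assms(1)
proof (induction m arbitrary: n)
  case 0
  then show ?case using assms(2) by (cases n) auto
next
  case (Suc m)
  then show ?case using assms(3) by (cases n) auto
qed

lemma hd_word_of_index: "word_of_index ks = [] \<or> hd (word_of_index ks) = Y"
  by (cases ks) (auto simp: word_of_index_def)

lemma word_of_index_inject:
  assumes "word_of_index ks = word_of_index ls" "\<forall>k\<in>set ks. k \<ge> 1" "\<forall>l\<in>set ls. l \<ge> 1"
  shows "ks = ls"
  using assms
proof (induction ks arbitrary: ls)
  case Nil
  then show ?case by (cases ls) (auto simp: word_of_index_def)
next
  case (Cons k ks)
  from Cons.prems(1) obtain l ls' where ls: "ls = l # ls'"
    by (cases ls) (auto simp: word_of_index_def)
  have "k - 1 = l - 1 \<and> word_of_index ks = word_of_index ls'"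
    using Cons.prems(1) hd_word_of_index[of ks] hd_word_of_index[of ls']
    by (intro replicate_X_append_inject) (auto simp: ls word_of_index_def)
  moreover have "k \<ge> 1" "l \<ge> 1" using Cons.prems(2,3) by (auto simp: ls)
  ultimately have "k = l" "word_of_index ks = word_of_index ls'" by linarith+
  then show ?case using Cons.IH[of ls'] Cons.prems(2,3) by (auto simp: ls)
qed

lemma Zdiamond_word: "Zdiamond (word u) = Zdiamond_word u"
  by (rule ext) (simp add: Zdiamond_def)

lemma Zdiamond_1: "Zdiamond 1 N = 1"
  by (simp add: Zdiamond_word Zdiamond_word_def word_Nil[symmetric])

lemma Zdiamond_index:
  assumes "admissible ks"
  shows "Zdiamond (prod_list (map gen_z ks)) = zeta_diamond ks"
proof -
  have "word_of_index ks \<noteq> []"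
    using assms by (cases ks) (auto simp: admissible_def word_of_index_def)
  moreover have "(THE ls. admissible ls \<and> word_of_index ls = word_of_index ks) = ks"
    by (rule the_equality) (use assms in \<open>auto simp: admissible_def intro: word_of_index_inject\<close>)
  ultimately show ?thesis
    using word_of_index_eq[of ks] assms Zdiamond_word[of "word_of_index ks"]
    by (simp add: Zdiamond_word_def admissible_def)
qed

lemma Zdiamond_add: "Zdiamond (p + q) N = Zdiamond p N + Zdiamond q N"
  unfolding Zdiamond_def
  by (rule setsum_keys_plus_distrib) (auto simp: algebra_simps)


section \<open>Membership in the domains\<close>

lemma H0_int: "of_int c \<in> H0"
  unfolding H0_def by (rule CollectI, rule exI[of _ c], rule exI[of _ 0]) simp

lemma H0_yx: "gen_y * h * gen_x \<in> H0"
  unfolding H0_def by (rule CollectI, rule exI[of _ 0], rule exI[of _ h]) simp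

lemma H0_diff: "p \<in> H0 \<Longrightarrow> q \<in> H0 \<Longrightarrow> p - q \<in> H0"
proof -
  assume "p \<in> H0" "q \<in> H0"
  then obtain c h d k where "p = of_int c + gen_y * h * gen_x" "q = of_int d + gen_y * k * gen_x"
    by (auto simp: H0_def)
  then have "p - q = of_int (c - d) + gen_y * (h - k) * gen_x" by (simp add: algebra_simps)
  then show ?thesis unfolding H0_def by blast
qed

lemma H0_mult: "p \<in> H0 \<Longrightarrow> q \<in> H0 \<Longrightarrow> p * q \<in> H0"
proof -
  assume "p \<in> H0" "q \<in> H0"
  then obtain c h d k where p: "p = of_int c + gen_y * h * gen_x"
    and q: "q = of_int d + gen_y * k * gen_x"
    by (auto simp: H0_def)
  have "gen_y * h * gen_x * of_int d = gen_y * (of_int d * h) * gen_x"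
       "of_int c * (gen_y * k * gen_x) = gen_y * (of_int c * k) * gen_x"
    by (metis mult.assoc mult_of_int_commute)+
  then have "p * q = of_int (c * d) + gen_y * (of_int d * h + of_int c * k + h * gen_x * gen_y * k) * gen_x"
    by (simp add: p q algebra_simps)
  then show ?thesis unfolding H0_def by blast
qed

lemma tau_of_int: "tau (of_int c) = of_int c"
proof -
  have n: "tau (of_nat n) = of_nat n" for n
    by (induction n) (simp_all add: tau_0 tau_1 tau_add)
  show ?thesis
    by (cases c rule: int_diff_cases) (simp add: tau_diff n)
qed

lemma tau_H0: "p \<in> H0 \<Longrightarrow> tau p \<in> H0"
proof -
  assume "p \<in> H0"
  then obtain c h where "p = of_int c + gen_y * h * gen_x" by (auto simp: H0_def)
  then have "tau p = of_int c + gen_y * tau h * gen_x"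
    by (simp add: tau_add tau_mult tau_of_int tau_x tau_y mult.assoc)
  then show ?thesis unfolding H0_def by blast
qed

lemma H23_subset_H0: "H23 \<subseteq> H0"
proof
  fix p assume "p \<in> H23"
  then show "p \<in> H0"
  proof induction
    case one
    show ?case using H0_int[of 1] by simp
  next
    case z2
    show ?case using H0_yx[of 1] by (simp add: gen_z_def)
  next
    case z3
    show ?case using H0_yx[of gen_x] by (simp add: gen_z_def numeral_eq_Suc mult.assoc)
  qed (auto intro: H0_diff H0_mult)
qed

lemma mult_tau_in_H0: "p \<in> H23 \<Longrightarrow> q \<in> H23 \<Longrightarrow> p * tau q \<in> H0"
  using H23_subset_H0 by (auto intro: H0_mult tau_H0)

lemma H23_0: "0 \<in> H23"
  using H23.diff[OF H23.one H23.one] by simp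

lemma H23_add: "p \<in> H23 \<Longrightarrow> q \<in> H23 \<Longrightarrow> p + q \<in> H23"
  using H23.diff[of p "0 - q"] H23.diff[OF H23_0, of q] by simp

lemma H23_word: "u \<in> words23 \<Longrightarrow> word u \<in> H23"
  by (induction rule: words23.induct)
     (auto simp: word_Nil simp flip: word_mult z2_eq z3_eq intro: H23.intros)

lemma words23_append: "v \<in> words23 \<Longrightarrow> u \<in> words23 \<Longrightarrow> u @ v \<in> words23"
  by (induction v rule: words23.induct) (auto simp flip: append_assoc intro: words23.intros)

lemma H23_iff: "p \<in> H23 \<longleftrightarrow> Poly_Mapping.keys p \<subseteq> words23"
proof
  assume "p \<in> H23"
  then show "Poly_Mapping.keys p \<subseteq> words23"
  proof induction
    case one
    show ?case by (simp flip: word_Nil add: words23.Nil)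
  next
    case z2
    show ?case using words23.snoc_z2[OF words23.Nil] by (simp add: z2_eq)
  next
    case z3
    show ?case using words23.snoc_z3[OF words23.Nil] by (simp add: z3_eq)
  next
    case (diff p q)
    then show ?case using keys_diff[of p q] by blast
  next
    case (mult p q)
    then show ?case using keys_mult[of p q] words23_append by (fastforce simp: plus_list_def)
  qed
next
  assume "Poly_Mapping.keys p \<subseteq> words23"
  then show "p \<in> H23"
    by (induction p rule: frag_induction) (auto intro: H23_0 H23_word H23.diff)
qed

lemma word_snoc: "word (u @ [Y, X]) = word u * gen_z 2" "word (u @ [Y, X, X]) = word u * gen_z 3"
  by (simp_all add: z2_eq z3_eq word_mult)

lemma star_word_in_H23:
  "u \<in> words23 \<Longrightarrow> v \<in> words23 \<Longrightarrow> word u \<star> word v \<in> H23"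
proof (induction u arbitrary: v rule: words23.induct)
  case Nil
  then show ?case by (simp add: word_Nil star_1_left H23_word)
next
  case (snoc_z2 u)
  then show ?case
    by (simp add: word_snoc star_z2_left H23.intros)
next
  case u: (snoc_z3 u)
  from u.prems show ?case
  proof (induction v rule: words23.induct)
    case Nil
    show ?case using H23_word[OF words23.snoc_z3[OF u.hyps]] by (simp add: word_Nil star_1_right)
  next
    case (snoc_z2 v)
    then show ?case
      using star_z2_right[OF words23.snoc_z3[OF u.hyps], of v]
      by (simp add: word_snoc H23.intros)
  next
    case (snoc_z3 v)
    have "gen_z 2 ^ 3 \<in> H23" by (auto simp: power3_eq_cube intro: H23.intros)
    then show ?case
      using snoc_z3.IH u.IH[OF snoc_z3.hyps] u.IH[OF words23.snoc_z3[OF snoc_z3.hyps]]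
      by (simp add: word_snoc star_z3_z3 H23_add H23.intros)
  qed
qed

lemma star_in_H23:
  assumes "p \<in> H23" "q \<in> H23"
  shows "p \<star> q \<in> H23"
proof -
  have *: "word u \<star> q \<in> H23" if "u \<in> words23" for u
    using assms(2) unfolding H23_iff[of q]
    by (induction q rule: frag_induction)
       (auto simp: star_0_right star_diff_right intro: H23_0 H23.diff star_word_in_H23 that)
  show ?thesis
    using assms(1) unfolding H23_iff[of p]
    by (induction p rule: frag_induction)
       (auto simp: star_0_left star_diff_left intro: H23_0 H23.diff *)
qed

end

theory Submission
  imports Defs "HOL-Library.FuncSet"
begin

text \<open>
  Let \<open>g\<^sub>u(n)\<close> be the part of the truncated multiple harmonic sum of a word \<open>u\<close> in \<open>z\<^sub>2, z\<^sub>3\<close> with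
  largest index \<open>n\<close>, and \<open>f\<^sub>u(m)\<close> the part of the diamond value with last index \<open>m\<close>. The triangular
  transform with kernel \<open>binomial(m, n) / binomial(N-1, n)\<close> turns both letters of the harmonic model
  into those of the diamond model, so it maps \<open>g\<^sub>u\<close> to the partial sums of \<open>f\<^sub>u\<close>. The reflection
  \<open>n \<mapsto> N - n\<close> exchanges the letters, and Vandermonde's identity then gives
  \<open>Z\<^sub>N(u \<tau>(v)) = \<Sum> g\<^sub>u(n) g\<^sub>v(m) C\<^sub>N(n,m)\<close> with a finite version \<open>C\<^sub>N\<close> of the Seki--Yamamoto connector
  \<open>n! m! / (n+m)!\<close>. The difference \<open>C\<^bsub>N+1\<^esub> - C\<^sub>N\<close> satisfies two contiguity relations that make these
  connected sums obey, as functions of \<open>N\<close>, the recursion defining \<open>\<star>\<close>.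
\<close>

section \<open>Harmonic and diamond summands\<close>

text \<open>
  The words in \<open>harm\<close> and \<open>density\<close> are reversed, and the empty word is placed at index \<open>0\<close>.
  Division by zero makes both functions vanish at \<open>0\<close> for non-empty words. In \<open>density\<close> a \<open>Y\<close> is always
  separated strictly from what precedes it; this agrees with the diamond sum for words without \<open>yy\<close>.
\<close>

fun harm :: "letter list \<Rightarrow> nat \<Rightarrow> rat" where
  "harm [] n = (if n = 0 then 1 else 0)"
| "harm (X # l) n = harm l n / of_nat n"
| "harm (Y # l) n = (\<Sum>k<n. harm l k) / of_nat n"

fun density :: "nat \<Rightarrow> letter list \<Rightarrow> nat \<Rightarrow> rat" where
  "density N [] m = (if m = 0 then 1 else 0)"
| "density N (X # l) m = (\<Sum>k\<le>m. density N l k) / of_nat m"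
| "density N (Y # l) m = (\<Sum>k<m. density N l k) / (of_nat N - of_nat m)"

lemma harm_0: "l \<noteq> [] \<Longrightarrow> harm l 0 = 0"
  by (cases l rule: list.exhaust; cases "hd l") auto

section \<open>Summation by parts and the binomial kernel of the transform\<close>

text \<open>The inner sum is empty at \<open>n = 0\<close>, so the truncated \<open>n - 1\<close>
  there is harmless.\<close>

lemma abel_sum:
  fixes g t :: "nat \<Rightarrow> 'a::comm_ring_1"
  shows "(\<Sum>n\<le>K. (\<Sum>a<n. g a) * (t (n - 1) - t n)) = (\<Sum>a<K. g a * t a) - (\<Sum>a<K. g a) * t K"
  by (induction K) (simp_all add: algebra_simps)

text \<open>The backward difference of \<open>m choose n\<close> in \<open>m\<close>, where the
  value at \<open>m = -1\<close> is read as \<open>0\<close>.\<close>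

fun choose_diff :: "nat \<Rightarrow> nat \<Rightarrow> nat" where
  "choose_diff 0 0 = 1"
| "choose_diff (Suc n) (Suc m) = m choose n"
| "choose_diff _ _ = 0"

lemma sum_choose_diff: "(\<Sum>k\<le>m. choose_diff n k) = m choose n"
  by (induction m) (cases n; simp)+

text \<open>For \<open>n > 0\<close>, sort the subsets of \<open>{1..M}\<close> with
  \<open>n + p\<close> elements by their \<open>n\<close>-th smallest element \<open>m\<close>:
  \<open>n - 1\<close> elements lie below it and \<open>p\<close> above. For \<open>n = 0\<close>
  only \<open>m = 0\<close> contributes. The induction uses Pascal's rule on the second
  factor.\<close>

lemma choose_diff_vandermonde:
  "(\<Sum>m\<le>M. choose_diff n m * ((M - m) choose p)) = M choose (n + p)"
proof (induction M arbitrary: p)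
  case 0
  show ?case by (cases n; cases p) auto
next
  case (Suc M)
  show ?case
  proof (cases p)
    case 0
    then show ?thesis using sum_choose_diff[of n "Suc M"] by simp
  next
    case (Suc q)
    have "(\<Sum>m\<le>M. choose_diff n m * ((Suc M - m) choose p))
        = (\<Sum>m\<le>M. choose_diff n m * ((M - m) choose q) + choose_diff n m * ((M - m) choose p))"
      by (rule sum.cong) (simp_all add: Suc Suc_diff_le algebra_simps)
    then show ?thesis
      by (simp add: Suc.IH sum.distrib Suc)
  qed
qed

text \<open>This exchanges the factor \<open>1/m\<close> of the diamond letter \<open>X\<close> for
  the factor \<open>1/n\<close> of the harmonic letter \<open>X\<close>.\<close>

lemma choose_diff_absorb: "m * choose_diff n m = n * (m choose n)"
proof (cases n)
  case (Suc j)
  then show ?thesis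
    using Suc_times_binomial[of j] by (cases m) (simp_all del: mult_Suc binomial_Suc_Suc)
qed (cases m; simp)

lemma of_nat_choose_Suc:
  "(of_nat (Suc k) * of_nat (q choose Suc k) :: rat) = (of_nat q - of_nat k) * of_nat (q choose k)"
  using gbinomial_mult_1[of "of_nat q :: rat" k] unfolding binomial_gbinomial by (simp add: algebra_simps)

lemma of_nat_Suc_choose:
  "((of_nat (Suc M) - of_nat k) * of_nat (Suc M choose k) :: rat) = of_nat (Suc M) * of_nat (M choose k)"
  using gbinomial_absorb_comp[of "of_nat (Suc M) :: rat" k] unfolding binomial_gbinomial by simp

text \<open>Passing from a density to its partial sums turns the kernel \<open>choose_diff\<close>
  into the binomial coefficient.\<close>

lemma sum_choose_diff_kernel:
  fixes a b :: "nat \<Rightarrow> 'a::field_char_0"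
  shows "(\<Sum>k\<le>m. \<Sum>n\<le>M. a n * (of_nat (choose_diff n k) / b n)) = (\<Sum>n\<le>M. a n * (of_nat (m choose n) / b n))"
proof -
  have "(\<Sum>k\<le>m. \<Sum>n\<le>M. a n * (of_nat (choose_diff n k) / b n)) = (\<Sum>n\<le>M. a n * (of_nat (\<Sum>k\<le>m. choose_diff n k) / b n))"
    by (subst sum.swap) (simp add: sum_distrib_left sum_divide_distrib)
  then show ?thesis by (simp add: sum_choose_diff)
qed

text \<open>Induction along the reversed word, with \<open>N = M + 1\<close>. For \<open>X\<close>,
  \<open>choose_diff_absorb\<close> trades \<open>1/p\<close> for \<open>1/n\<close>. For
  \<open>Y\<close> and \<open>p = Suc q\<close>, the new kernel times \<open>M - q\<close> and
  \<open>1/n\<close> is the difference \<open>?t (n - 1) - ?t n\<close> of binomial kernels, so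
  summation by parts applies. The premise on \<open>last l\<close> makes the rest non-empty after an
  \<open>X\<close>, so that its \<open>harm\<close> vanishes at \<open>0\<close>.\<close>

lemma density_eq_sum_harm:
  assumes "l = [] \<or> last l = Y" "p \<le> M"
  shows "density (Suc M) l p = (\<Sum>n\<le>M. harm l n * (of_nat (choose_diff n p) / of_nat (M choose n)))"
  using assms
proof (induction l arbitrary: p)
  case Nil
  have "(\<Sum>n\<le>M. harm [] n * (of_nat (choose_diff n p) / of_nat (M choose n)))
    = (\<Sum>n\<le>M. if n = 0 then of_nat (choose_diff 0 p) else 0)"
    by (rule sum.cong) auto
  then show ?case by (cases p) (simp_all add: sum.delta)
next
  case (Cons c l)
  have IH: "(\<Sum>k\<le>q. density (Suc M) l k) = (\<Sum>n\<le>M. harm l n * (of_nat (q choose n) / of_nat (M choose n)))"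
    if "l = [] \<or> last l = Y" "q \<le> M" for q
    using that by (simp add: Cons.IH sum_choose_diff_kernel del: times_divide_eq_right)
  show ?case
  proof (cases c)
    case X
    with Cons.prems have l: "l \<noteq> []" "last l = Y" by (auto split: if_splits)
    have "density (Suc M) (c # l) p
       = (\<Sum>n\<le>M. harm l n * (of_nat (p choose n) / of_nat (M choose n))) / of_nat p"
      using IH[of p] l Cons.prems by (simp add: X)
    also have "\<dots> = (\<Sum>n\<le>M. harm (c # l) n * (of_nat (choose_diff n p) / of_nat (M choose n)))"
      unfolding sum_divide_distrib
    proof (rule sum.cong[OF refl])
      fix n assume "n \<in> {..M}"
      show "harm l n * (of_nat (p choose n) / of_nat (M choose n)) / of_nat p =
         harm (c # l) n * (of_nat (choose_diff n p) / of_nat (M choose n))"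
      \<comment> \<open>Division by zero gives \<open>0\<close> here. Both sides vanish, for
        \<open>n = 0\<close> because \<open>l\<close> is non-empty.\<close>
      proof (cases "n = 0 \<or> p = 0")
        case True
        then show ?thesis using harm_0[OF l(1)] by (cases n; cases p) (auto simp: X)
      next
        case False
        moreover have "(of_nat p * of_nat (choose_diff n p) :: rat) = of_nat n * of_nat (p choose n)"
          unfolding of_nat_mult[symmetric] choose_diff_absorb ..
        ultimately show ?thesis by (simp add: X divide_simps algebra_simps)
      qed
    qed
    finally show ?thesis .
  next
    case Y
    show ?thesis
    proof (cases p)
      case 0
      have "harm (c # l) n * (of_nat (choose_diff n p) / of_nat (M choose n)) = 0" for n
        by (cases n) (auto simp: Y 0)
      then show ?thesis unfolding Y 0 by (simp only: sum.neutral_const) simp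
    next
      case (Suc q)
      let ?t = "\<lambda>n. of_nat (q choose n) / of_nat (M choose n) :: rat"
      have IH: "(\<Sum>k\<le>q. density (Suc M) l k) = (\<Sum>n\<le>M. harm l n * ?t n)"
        using Cons.prems by (intro IH) (auto simp: Suc split: if_splits)
      have "(\<Sum>n\<le>M. harm (c # l) n * (of_nat (choose_diff n p) / of_nat (M choose n))) * (of_nat M - of_nat q)
         = (\<Sum>n\<le>Suc M. (\<Sum>a<n. harm l a) * (?t (n - 1) - ?t n))"
      proof -
        have step: "harm (c # l) n * (of_nat (choose_diff n p) / of_nat (M choose n)) * (of_nat M - of_nat q)
           = (\<Sum>a<n. harm l a) * (?t (n - 1) - ?t n)" if n: "n \<le> M" for n
        proof (cases n)
          case (Suc j)
          define x y where "x = (of_nat (q choose j) :: rat)" and "y = (of_nat (M choose j) :: rat)"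
          define x' y' where "x' = (of_nat (q choose Suc j) :: rat)" and "y' = (of_nat (M choose Suc j) :: rat)"
          have 1: "of_nat (Suc j) * x' = (of_nat q - of_nat j) * x" "of_nat (Suc j) * y' = (of_nat M - of_nat j) * y"
            unfolding x_def y_def x'_def y'_def by (rule of_nat_choose_Suc)+
          have pos: "y \<noteq> 0" "y' \<noteq> 0" "of_nat (Suc j) \<noteq> (0::rat)" "of_nat M \<noteq> (of_nat j :: rat)"
            using n Suc unfolding y_def y'_def by simp_all
          have "x / y = x * (of_nat M - of_nat j) / (of_nat (Suc j) * y')"
            using pos 1 by (simp add: frac_eq_eq mult_ac del: of_nat_Suc)
          moreover have "x' / y' = x * (of_nat q - of_nat j) / (of_nat (Suc j) * y')"
            using pos 1(1) by (simp add: frac_eq_eq mult_ac del: of_nat_Suc)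
          ultimately have "x / y' * (of_nat M - of_nat q) / of_nat (Suc j) = x / y - x' / y'"
            using pos by (simp add: diff_divide_distrib[symmetric] algebra_simps del: of_nat_Suc)
          then have "(\<Sum>a<n. harm l a) * (x / y' * (of_nat M - of_nat q) / of_nat (Suc j)) = (\<Sum>a<n. harm l a) * (x / y - x' / y')"
            by (rule arg_cong)
          moreover have "harm (c # l) n * (of_nat (choose_diff n p) / of_nat (M choose n)) * (of_nat M - of_nat q)
             = (\<Sum>a<n. harm l a) * (x / y' * (of_nat M - of_nat q) / of_nat (Suc j))"
            unfolding x_def y'_def by (simp add: Y Suc \<open>p = Suc q\<close> mult_ac del: of_nat_Suc sum.lessThan_Suc)
          ultimately show ?thesis
            unfolding x_def y_def x'_def y'_def Suc by simp
        qed (simp add: Y)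
        \<comment> \<open>As \<open>q < M\<close>, the extra summand at \<open>n = Suc M\<close> is
          zero, and so is the boundary term that summation by parts leaves.\<close>
        have zero: "?t M = 0" "?t (Suc M) = 0" using Cons.prems Suc by simp_all
        have "(\<Sum>n\<le>M. harm (c # l) n * (of_nat (choose_diff n p) / of_nat (M choose n))) * (of_nat M - of_nat q)
           = (\<Sum>n\<le>M. (\<Sum>a<n. harm l a) * (?t (n - 1) - ?t n))"
          by (subst sum_distrib_right) (rule sum.cong[OF refl], rule step, simp)
        then show ?thesis
          by (simp only: sum.atMost_Suc diff_Suc_1 zero diff_self mult_zero_right add_0_right)
      qed
      also have "\<dots> = (\<Sum>a\<le>M. harm l a * ?t a)"
        by (subst abel_sum[of "harm l" ?t "Suc M"]) (simp add: lessThan_Suc_atMost)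
      finally have "(\<Sum>n\<le>M. harm (c # l) n * (of_nat (choose_diff n p) / of_nat (M choose n))) * (of_nat M - of_nat q)
         = (\<Sum>a\<le>M. harm l a * ?t a)" .
      moreover have "(of_nat M - of_nat q :: rat) \<noteq> 0" using Cons.prems Suc by simp
      ultimately have "(\<Sum>n\<le>M. harm (c # l) n * (of_nat (choose_diff n p) / of_nat (M choose n)))
         = (\<Sum>a\<le>M. harm l a * ?t a) / (of_nat M - of_nat q)"
        using nonzero_eq_divide_eq by blast
      then show ?thesis
        by (simp only: Y Suc density.simps lessThan_Suc_atMost IH of_nat_Suc add_diff_cancel_left)
    qed
  qed
qed

lemma sum_density:
  assumes "l = [] \<or> last l = Y" "m \<le> M"
  shows "(\<Sum>k\<le>m. density (Suc M) l k) = (\<Sum>n\<le>M. harm l n * (of_nat (m choose n) / of_nat (M choose n)))"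
  using assms by (simp add: density_eq_sum_harm sum_choose_diff_kernel del: times_divide_eq_right)

section \<open>The connected sum\<close>

text \<open>Here \<open>M = N - 1\<close>. For fixed \<open>n\<close> and \<open>m\<close> the value
  tends to \<open>n! m! / (n + m)!\<close> as \<open>M\<close> grows.\<close>

definition conn :: "nat \<Rightarrow> nat \<Rightarrow> nat \<Rightarrow> rat" where
  "conn M n m = of_nat (M choose (n + m)) / (of_nat (M choose n) * of_nat (M choose m))"

definition connected_sum :: "nat \<Rightarrow> letter list \<Rightarrow> letter list \<Rightarrow> rat" where
  "connected_sum M l l' = (\<Sum>n\<le>M. \<Sum>m\<le>M. harm l n * harm l' m * conn M n m)"

lemma conn_commute: "conn M n m = conn M m n"
  by (simp add: conn_def add.commute mult.commute)

lemma conn_eq_0: "n + m > M \<Longrightarrow> conn M n m = 0"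
  by (simp add: conn_def)

lemma conn_0_right: "n \<le> M \<Longrightarrow> conn M n 0 = 1"
  by (simp add: conn_def)

lemma connected_sum_commute: "connected_sum M l l' = connected_sum M l' l"
  unfolding connected_sum_def by (subst sum.swap) (simp add: conn_commute mult_ac)

text \<open>Padding with zero terms gives the sums at \<open>M\<close> and \<open>Suc M\<close> a
  common range, so that they can be subtracted termwise.\<close>

lemma connected_sum_Suc:
  "connected_sum M l l' = (\<Sum>n\<le>Suc M. \<Sum>m\<le>Suc M. harm l n * harm l' m * conn M n m)"
  by (simp add: connected_sum_def conn_eq_0)

lemma connected_sum_Nil: "connected_sum M l [] = (\<Sum>n\<le>M. harm l n)"
proof -
  have "(\<Sum>m\<le>M. harm l n * harm [] m * conn M n m) = harm l n" if "n \<le> M" for n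
  proof -
    have "(\<Sum>m\<le>M. harm l n * harm [] m * conn M n m) = (\<Sum>m\<le>M. if m = 0 then harm l n else 0)"
      using that by (intro sum.cong) (auto simp: conn_0_right)
    then show ?thesis by (simp add: sum.delta)
  qed
  then show ?thesis by (simp add: connected_sum_def)
qed

lemma connected_sum_0: "l \<noteq> [] \<Longrightarrow> connected_sum 0 l l' = 0"
  by (simp add: connected_sum_def harm_0)

section \<open>Contiguity relations of the connector\<close>

lemma conn_Suc_ratio:
  assumes "n + m \<le> M"
  shows "of_nat (Suc M) * (of_nat (Suc M) - of_nat (n + m)) * conn (Suc M) n m
    = (of_nat (Suc M) - of_nat n) * (of_nat (Suc M) - of_nat m) * conn M n m"
proof -
  define N where "N = (of_nat (Suc M) :: rat)"
  define a b c where "a = (of_nat (Suc M choose (n + m)) :: rat)" and "b = (of_nat (Suc M choose n) :: rat)"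
    and "c = (of_nat (Suc M choose m) :: rat)"
  define a' b' c' where "a' = (of_nat (M choose (n + m)) :: rat)" and "b' = (of_nat (M choose n) :: rat)"
    and "c' = (of_nat (M choose m) :: rat)"
  have eq: "(N - of_nat (n + m)) * a = N * a'" "(N - of_nat n) * b = N * b'" "(N - of_nat m) * c = N * c'"
    unfolding N_def a_def b_def c_def a'_def b'_def c'_def by (rule of_nat_Suc_choose)+
  have nz: "b \<noteq> 0" "c \<noteq> 0" "b' \<noteq> 0" "c' \<noteq> 0" "N \<noteq> 0"
    using assms by (simp_all add: b_def c_def b'_def c'_def N_def del: of_nat_Suc binomial_Suc_Suc)
  have b: "(N - of_nat n) / b' = N / b" and c: "(N - of_nat m) / c' = N / c"
    using eq nz by (simp_all add: frac_eq_eq mult.commute)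
  have "N * (N - of_nat (n + m)) * (a / (b * c)) = ((N - of_nat (n + m)) * a) * (N / b / c)"
    by simp
  also have "\<dots> = (N / b) * (N / c) * a'"
    unfolding eq by simp
  also have "\<dots> = (N - of_nat n) * (N - of_nat m) * (a' / (b' * c'))"
    unfolding b[symmetric] c[symmetric] by simp
  finally show ?thesis
    unfolding conn_def N_def a_def b_def c_def a'_def b'_def c'_def .
qed

lemma conn_pred_ratio:
  assumes "n < M" "m \<le> M"
  shows "of_nat (Suc n) * (of_nat M - of_nat (n + m)) * conn M n m
    = (of_nat M - of_nat n) * of_nat (Suc (n + m)) * conn M (Suc n) m"
proof -
  define a b c where "a = (of_nat (M choose (n + m)) :: rat)" and "b = (of_nat (M choose n) :: rat)"
    and "c = (of_nat (M choose m) :: rat)"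
  define a' b' where "a' = (of_nat (M choose Suc (n + m)) :: rat)" and "b' = (of_nat (M choose Suc n) :: rat)"
  have eq: "of_nat (Suc (n + m)) * a' = (of_nat M - of_nat (n + m)) * a" "of_nat (Suc n) * b' = (of_nat M - of_nat n) * b"
    unfolding a_def b_def a'_def b'_def by (rule of_nat_choose_Suc)+
  have nz: "b \<noteq> 0" "b' \<noteq> 0"
    using assms by (simp_all add: b_def b'_def)
  have b: "of_nat (Suc n) / b = (of_nat M - of_nat n) / b'"
    using eq nz by (simp add: frac_eq_eq)
  have "of_nat (Suc n) * (of_nat M - of_nat (n + m)) * (a / (b * c)) = (of_nat (Suc n) / b) * ((of_nat M - of_nat (n + m)) * a) / c"
    by simp
  also have "\<dots> = (of_nat M - of_nat n) * of_nat (Suc (n + m)) * (a' / (b' * c))"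
    unfolding b eq(1)[symmetric] by simp
  finally show ?thesis
    unfolding conn_def a_def b_def c_def a'_def b'_def by simp
qed

text \<open>With \<open>N = Suc M\<close>, this is \<open>conn_Suc_ratio\<close> and
  \<open>(N - n)(N - m) - N(N - n - m) = n m\<close>. On the boundary \<open>n + m = N\<close> the
  factor on the left is zero.\<close>

lemma conn_Suc_diff:
  "of_nat (Suc M) * (of_nat (Suc M) - of_nat (n + m)) * (conn (Suc M) n m - conn M n m) = of_nat n * of_nat m * conn M n m"
proof -
  consider "n + m \<le> M" | "n + m = Suc M" | "n + m > Suc M" by linarith
  then show ?thesis
  proof cases
    case 1
    then show ?thesis
      using conn_Suc_ratio[OF 1] unfolding of_nat_add by algebra
  qed (simp_all add: conn_eq_0)
qed

text \<open>The right-hand side is a difference in \<open>n\<close>, so a sum over \<open>n\<close>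
  can be taken by parts once the square is cancelled by the two factors \<open>1/n\<close> of a
  final \<open>z_2\<close>.\<close>

lemma conn_Suc_diff_left:
  "of_nat (Suc M) ^ 2 * (conn (Suc M) (Suc n) m - conn M (Suc n) m) = of_nat (Suc n) ^ 2 * (conn M n m - conn M (Suc n) m)"
proof -
  consider "Suc n + m \<le> M" | "n + m = M" | "n + m > M" by linarith
  then show ?thesis
  proof cases
    case 1
    define N k where "N = (of_nat (Suc M) :: rat)" and "k = (of_nat (Suc n) :: rat)"
    define D where "D = conn (Suc M) (Suc n) m - conn M (Suc n) m"
    have nz: "N - (k + of_nat m) \<noteq> 0"
    proof -
      have "of_nat (Suc M) \<noteq> (of_nat (Suc n + m) :: rat)" using 1 unfolding of_nat_eq_iff by simp
      then show ?thesis by (simp add: N_def k_def)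
    qed
    have 2: "N * (N - (k + of_nat m)) * D = k * of_nat m * conn M (Suc n) m"
      using conn_Suc_diff[of M "Suc n" m] unfolding N_def k_def D_def by (simp add: algebra_simps)
    have 3: "k * (N - (k + of_nat m)) * conn M n m = (N - k) * (k + of_nat m) * conn M (Suc n) m"
      using conn_pred_ratio[of n M m] 1 unfolding N_def k_def by (simp add: algebra_simps)
    \<comment> \<open>The identity behind this is
      \<open>(N - k)(k + m) - k(N - k - m) = N m\<close>.\<close>
    have "(N - (k + of_nat m)) * (N ^ 2 * D) = (N - (k + of_nat m)) * (k ^ 2 * (conn M n m - conn M (Suc n) m))"
      using 2 3 by algebra
    then show ?thesis using nz unfolding N_def k_def D_def by simp
  next
    \<comment> \<open>Now \<open>N - (k + m) = 0\<close> and cannot be cancelled. Symmetry of the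
      binomial coefficients turns both remaining connectors into inverse squares.\<close>
    case 2
    then have m: "m = M - n" by simp
    have "M choose m = M choose n" "Suc M choose m = Suc M choose Suc n"
      using 2 binomial_symmetric[of n M] binomial_symmetric[of "Suc n" "Suc M"] m by auto
    then have conn: "conn M n m = 1 / of_nat (M choose n) ^ 2" "conn M (Suc n) m = 0"
        "conn (Suc M) (Suc n) m = 1 / of_nat (Suc M choose Suc n) ^ 2"
      using 2 by (simp_all add: conn_def power2_eq_square del: binomial_Suc_Suc)
    have nz: "(of_nat (M choose n) :: rat) \<noteq> 0" "(of_nat (Suc M choose Suc n) :: rat) \<noteq> 0"
      using 2 by (simp_all del: binomial_Suc_Suc)
    have "(of_nat (Suc M) * of_nat (M choose n) :: rat) = of_nat (Suc n) * of_nat (Suc M choose Suc n)"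
      unfolding of_nat_mult[symmetric] of_nat_eq_iff using Suc_times_binomial by simp
    then have "(of_nat (Suc M) / of_nat (Suc M choose Suc n) :: rat) = of_nat (Suc n) / of_nat (M choose n)"
      using nz by (simp add: frac_eq_eq del: of_nat_Suc binomial_Suc_Suc)
    then have "(of_nat (Suc M) / of_nat (Suc M choose Suc n) :: rat) ^ 2 = (of_nat (Suc n) / of_nat (M choose n)) ^ 2"
      by (rule arg_cong)
    then show ?thesis
      unfolding conn by (simp add: power_divide del: of_nat_Suc binomial_Suc_Suc)
  qed (simp add: conn_eq_0)
qed

section \<open>Recursions for connected sums in the truncation level\<close>

text \<open>The square in \<open>conn_Suc_diff_left\<close> cancels the two factors
  \<open>1/n\<close> of the new letters, and summation by parts does the rest.\<close>

lemma connected_sum_z2: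
  "connected_sum (Suc M) (X # Y # l) l' - connected_sum M (X # Y # l) l' = connected_sum M l l' / of_nat (Suc M) ^ 2"
proof -
  let ?D = "\<lambda>n m. conn (Suc M) n m - conn M n m"
  have D: "harm (X # Y # l) n * ?D n m
     = (\<Sum>a<n. harm l a) * (conn M (n - 1) m - conn M n m) / of_nat (Suc M) ^ 2" for n m
  proof (cases n)
    case (Suc j)
    have "?D n m = of_nat n ^ 2 * (conn M (n - 1) m - conn M n m) / of_nat (Suc M) ^ 2"
      using conn_Suc_diff_left[of M j m] by (simp add: Suc field_simps del: of_nat_Suc)
    then show ?thesis by (simp add: Suc power2_eq_square del: of_nat_Suc)
  qed simp
  have "connected_sum (Suc M) (X # Y # l) l' - connected_sum M (X # Y # l) l'
      = (\<Sum>m\<le>Suc M. \<Sum>n\<le>Suc M. harm l' m * (harm (X # Y # l) n * ?D n m))"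
    unfolding connected_sum_Suc[of M] unfolding connected_sum_def
    by (subst sum.swap) (simp only: sum_subtractf[symmetric] right_diff_distrib mult_ac)
  also have "\<dots> = (\<Sum>m\<le>Suc M. harm l' m * (\<Sum>n\<le>Suc M. (\<Sum>a<n. harm l a) * (conn M (n - 1) m - conn M n m))) / of_nat (Suc M) ^ 2"
    by (simp only: D sum_distrib_left sum_divide_distrib times_divide_eq_right)
  \<comment> \<open>The boundary term vanishes since \<open>conn M (Suc M) m = 0\<close>.\<close>
  also have "(\<lambda>m. \<Sum>n\<le>Suc M. (\<Sum>a<n. harm l a) * (conn M (n - 1) m - conn M n m)) = (\<lambda>m. \<Sum>a\<le>M. harm l a * conn M a m)"
    by (simp only: abel_sum[where g = "harm l" and t = "\<lambda>n. conn M n _"] conn_eq_0 lessThan_Suc_atMost) (simp add: conn_eq_0)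
  also have "(\<Sum>m\<le>Suc M. harm l' m * (\<Sum>a\<le>M. harm l a * conn M a m)) = connected_sum M l l'"
    unfolding connected_sum_def
    by (subst sum.swap) (simp add: conn_eq_0 sum_distrib_left conn_commute mult_ac)
  finally show ?thesis .
qed

text \<open>Both sides are \<open>0\<close> at \<open>M = 0\<close> and have the same increments in
  \<open>M\<close>, by \<open>connected_sum_z2\<close> and the symmetry of connected sums.\<close>

lemma connected_sum_z2_swap: "connected_sum M (X # Y # l) l' = connected_sum M l (X # Y # l')"
proof (induction M)
  case 0
  show ?case by (simp add: connected_sum_0 connected_sum_commute[of 0 l])
next
  case (Suc M)
  have "connected_sum (Suc M) l (X # Y # l') - connected_sum M l (X # Y # l') = connected_sum M l l' / of_nat (Suc M) ^ 2"
    using connected_sum_z2[of M l' l] by (simp only: connected_sum_commute)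
  then show ?case using Suc connected_sum_z2[of M l l'] by linarith
qed

text \<open>Solving \<open>conn_Suc_diff\<close> for the increment gives three terms with factors
  \<open>n\<close>, \<open>m\<close> and \<open>n m\<close>. Each factor removes one
  \<open>X\<close> from the corresponding word, and \<open>connected_sum_z2\<close> evaluates the
  first two.\<close>

lemma connected_sum_z3_z3:
  "connected_sum (Suc M) (X # X # Y # l) (X # X # Y # l') - connected_sum M (X # X # Y # l) (X # X # Y # l')
   = (connected_sum M l (X # X # Y # l') + connected_sum M (X # X # Y # l) l') / of_nat (Suc M) ^ 3
     + connected_sum M (X # Y # l) (X # Y # l') / of_nat (Suc M) ^ 2"
proof -
  let ?D = "\<lambda>n m. conn (Suc M) n m - conn M n m"
  have diff: "connected_sum (Suc M) u v - connected_sum M u v = (\<Sum>n\<le>Suc M. \<Sum>m\<le>Suc M. harm u n * harm v m * ?D n m)" for u v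
    unfolding connected_sum_Suc[of M] unfolding connected_sum_def
    by (simp only: sum_subtractf[symmetric] right_diff_distrib)
  have D: "harm (X # X # Y # l) n * harm (X # X # Y # l') m * ?D n m
      = (harm (X # Y # l) n * harm (X # X # Y # l') m * ?D n m) / of_nat (Suc M)
      + (harm (X # X # Y # l) n * harm (X # Y # l') m * ?D n m) / of_nat (Suc M)
      + harm (X # Y # l) n * harm (X # Y # l') m * conn M n m / of_nat (Suc M) ^ 2" for n m
  proof (cases "n = 0 \<or> m = 0")
    case False
    define N where "N = (of_nat (Suc M) :: rat)"
    have [simp]: "N \<noteq> 0" unfolding N_def by simp
    define d where "d = ?D n m"
    have "N * (N - of_nat (n + m)) * d = of_nat n * of_nat m * conn M n m"
      using conn_Suc_diff unfolding N_def d_def by blast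
    then have d: "d = of_nat n * d / N + of_nat m * d / N + of_nat n * of_nat m * conn M n m / N ^ 2"
      by (simp add: field_simps power2_eq_square)
    show ?thesis unfolding d_def[symmetric] N_def[symmetric]
      by (subst d) (use False in \<open>simp add: field_simps\<close>)
  qed auto
  have "connected_sum (Suc M) (X # X # Y # l) (X # X # Y # l') - connected_sum M (X # X # Y # l) (X # X # Y # l')
     = (connected_sum (Suc M) (X # Y # l) (X # X # Y # l') - connected_sum M (X # Y # l) (X # X # Y # l')) / of_nat (Suc M)
     + (connected_sum (Suc M) (X # X # Y # l) (X # Y # l') - connected_sum M (X # X # Y # l) (X # Y # l')) / of_nat (Suc M)
     + connected_sum M (X # Y # l) (X # Y # l') / of_nat (Suc M) ^ 2"
    unfolding diff unfolding connected_sum_Suc[of M] D sum.distrib sum_divide_distrib ..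
  also have "connected_sum (Suc M) (X # X # Y # l) (X # Y # l') - connected_sum M (X # X # Y # l) (X # Y # l')
     = connected_sum M (X # X # Y # l) l' / of_nat (Suc M) ^ 2"
    using connected_sum_z2[of M l' "X # X # Y # l"] by (simp only: connected_sum_commute)
  finally show ?thesis
    unfolding connected_sum_z2 by (simp add: power2_eq_square power3_eq_cube add_divide_distrib del: of_nat_Suc)
qed

section \<open>Diamond values as connected sums\<close>

text \<open>The diamond sum read from left to right, with \<open>k\<close> a lower bound for the
  first index. Inequalities are strict exactly where \<open>X\<close> is followed by
  \<open>Y\<close>.\<close>

fun chain_sum :: "nat \<Rightarrow> letter list \<Rightarrow> nat \<Rightarrow> rat" where
  "chain_sum N [] k = 1"
| "chain_sum N (Y # u) k = (\<Sum>m=k..<N. 1 / (of_nat N - of_nat m) * chain_sum N u m)"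
| "chain_sum N (X # u) k = (\<Sum>m=k..<N. 1 / of_nat m * chain_sum N u (if hd u = Y then Suc m else m))"

text \<open>For empty \<open>u\<close> the value \<open>hd []\<close> is unspecified, but both
  branches are \<open>1\<close>.\<close>

lemma chain_sum_X:
  "u = [] \<or> hd u = Y \<Longrightarrow> chain_sum N (X # u) k = (\<Sum>m=k..<N. 1 / of_nat m * chain_sum N u (Suc m))"
  by auto

section \<open>Splitting a chain sum at an inner index\<close>

lemma sum_tails:
  fixes f h :: "nat \<Rightarrow> 'a::comm_ring_1"
  shows "(\<Sum>m<N. f m * (\<Sum>q=m..<N. h q)) = (\<Sum>q<N. (\<Sum>m\<le>q. f m) * h q)"
    and "(\<Sum>m<N. f m * (\<Sum>q=Suc m..<N. h q)) = (\<Sum>q<N. (\<Sum>m<q. f m) * h q)"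
proof (induction N)
  case (Suc N)
  {
    case 1
    show ?case
      using Suc.IH(1) by (simp add: sum.distrib distrib_left sum_distrib_right distrib_right lessThan_Suc_atMost[symmetric])
  next
    case 2
    show ?case
      using Suc.IH(2) by (simp add: sum.distrib distrib_left sum_distrib_right distrib_right)
  }
qed simp_all

text \<open>Exchanging the order of summation moves one letter from the tail into the prefix. The
  following two lemmas do this for \<open>X\<close>, before a strict and before a weak
  inequality.\<close>

lemma density_shift_Y:
  "(\<Sum>m<N. density N l m * chain_sum N (Y # v) (Suc m)) = (\<Sum>m<N. density N (Y # l) m * chain_sum N v m)"
  by (simp add: sum_tails)

lemma density_shift_X:
  "v = [] \<or> hd v = Y \<Longrightarrow>
    (\<Sum>m<N. density N l m * chain_sum N (X # v) m) = (\<Sum>m<N. density N (X # l) m * chain_sum N v (Suc m))"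
  by (simp add: chain_sum_X sum_tails del: chain_sum.simps)

lemma density_shift_XX:
  "(\<Sum>m<N. density N l m * chain_sum N (X # X # v) m) = (\<Sum>m<N. density N (X # l) m * chain_sum N (X # v) m)"
proof -
  have "chain_sum N (X # X # v) m = (\<Sum>q=m..<N. 1 / of_nat q * chain_sum N (X # v) q)" for m
    by simp
  then show ?thesis by (simp add: sum_tails del: chain_sum.simps)
qed

text \<open>The last factor \<open>z_2\<close> or \<open>z_3\<close> of \<open>u\<close> moves
  letter by letter from the tail into the density. The base case has all its mass at index
  \<open>0\<close>, which yields the lower bound \<open>1\<close>.\<close>

lemma chain_sum_append:
  assumes "u \<in> words23" "v = [] \<or> hd v = Y" "N > 0"
  shows "chain_sum N (u @ v) 1 = (\<Sum>m<N. density N (rev u) m * chain_sum N v (Suc m))"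
  using assms(1,2)
proof (induction u arbitrary: v rule: words23.induct)
  case Nil
  have "(\<Sum>m<N. density N [] m * chain_sum N v (Suc m)) = (\<Sum>m<N. if m = 0 then chain_sum N v 1 else 0)"
    by (rule sum.cong) auto
  then show ?case using assms(3) by (simp add: sum.delta)
next
  case (snoc_z2 u)
  then show ?case
    using snoc_z2.IH[of "Y # X # v"]
    by (simp add: density_shift_Y density_shift_X del: chain_sum.simps density.simps)
next
  case (snoc_z3 u)
  then show ?case
    using snoc_z3.IH[of "Y # X # X # v"]
    by (simp add: density_shift_Y density_shift_X density_shift_XX del: chain_sum.simps density.simps)
qed

section \<open>Reflection of the summation indices\<close>

lemma density_Cons_0: "density N (c # l) 0 = 0"
  by (cases c) auto

lemma sum_density_Cons: "(\<Sum>k\<le>K. density N (c # l) k) = (\<Sum>k=1..K. density N (c # l) k)"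
proof -
  have "(\<Sum>k\<le>K. density N (c # l) k) = (\<Sum>k\<in>{..K} - {0}. density N (c # l) k)"
    by (rule sum.mono_neutral_right) (auto simp: density_Cons_0)
  also have "{..K} - {0} = {1..K}" by auto
  finally show ?thesis .
qed

text \<open>The substitution of \<open>N - m\<close> for \<open>m\<close> exchanges
  \<open>1/m\<close> and \<open>1/(N - m)\<close>. The strict bound \<open>Suc m\<close> becomes the
  strict partial sum in the \<open>Y\<close> clause of \<open>density\<close>;
  \<open>chain_sum_reflect_Y\<close> is the weak counterpart.\<close>

lemma chain_sum_reflect_X:
  assumes "\<And>p. p \<in> {1..N} \<Longrightarrow> chain_sum N t p = (\<Sum>k\<le>N - p. density N l k)"
    and "t = [] \<or> hd t = Y" "p \<in> {1..N}"
  shows "chain_sum N (X # t) p = (\<Sum>k\<le>N - p. density N (Y # l) k)"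
  unfolding sum_density_Cons chain_sum_X[OF assms(2)]
proof (rule sum.reindex_bij_witness[where i = "\<lambda>q. N - q" and j = "\<lambda>q. N - q"])
  fix m assume "m \<in> {p..<N}"
  then have "Suc (N - Suc m) = N - m" by auto
  then have "{..N - Suc m} = {..<N - m}" using lessThan_Suc_atMost by metis
  then show "density N (Y # l) (N - m) = 1 / of_nat m * chain_sum N t (Suc m)"
    using \<open>m \<in> {p..<N}\<close> by (subst assms(1)) (auto simp: of_nat_diff)
qed (use assms(3) in auto)

lemma chain_sum_reflect_Y:
  assumes "\<And>p. p \<in> {1..N} \<Longrightarrow> chain_sum N t p = (\<Sum>k\<le>N - p. density N l k)"
    and "p \<in> {1..N}"
  shows "chain_sum N (Y # t) p = (\<Sum>k\<le>N - p. density N (X # l) k)"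
  unfolding sum_density_Cons chain_sum.simps
proof (rule sum.reindex_bij_witness[where i = "\<lambda>q. N - q" and j = "\<lambda>q. N - q"])
  fix m assume "m \<in> {p..<N}"
  then show "density N (X # l) (N - m) = 1 / (of_nat N - of_nat m) * chain_sum N t m"
    using assms(2) by (subst assms(1)) (auto simp: of_nat_diff)
qed (use assms(2) in auto)

lemma hd_map_swap_rev: "v \<in> words23 \<Longrightarrow> map swap_letter (rev v) = [] \<or> hd (map swap_letter (rev v)) = Y"
  by (induction v rule: words23.induct) auto

lemma chain_sum_tau:
  assumes "v \<in> words23" "p \<in> {1..N}"
  shows "chain_sum N (map swap_letter (rev v)) p = (\<Sum>k\<le>N - p. density N (rev v) k)"
  using assms
proof (induction v arbitrary: p rule: words23.induct)
  case Nil
  show ?case by (simp add: sum.delta)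
next
  case (snoc_z2 v)
  then show ?case
    using hd_map_swap_rev[OF snoc_z2.hyps]
    by (simp only: rev_append rev.simps append.simps list.map swap_letter.simps)
       (intro chain_sum_reflect_X chain_sum_reflect_Y)
next
  case (snoc_z3 v)
  then show ?case
    using hd_map_swap_rev[OF snoc_z3.hyps]
    by (simp only: rev_append rev.simps append.simps list.map swap_letter.simps)
       (intro chain_sum_reflect_X chain_sum_reflect_Y)
qed

lemma last_rev_words23: "u \<in> words23 \<Longrightarrow> rev u = [] \<or> last (rev u) = Y"
  by (induction u rule: words23.induct) auto

text \<open>Split at the last index \<open>m\<close> of \<open>u\<close>. By reflection the tail is
  the partial sum up to \<open>M - m\<close> of the density of \<open>v\<close>, and the transform
  makes both parts harmonic.\<close>

lemma chain_sum_connected_sum: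
  assumes "u \<in> words23" "v \<in> words23"
  shows "chain_sum (Suc M) (u @ map swap_letter (rev v)) 1 = connected_sum M (rev u) (rev v)"
proof -
  let ?N = "Suc M" and ?c = "\<lambda>n m. of_nat (m choose n) / of_nat (M choose n) :: rat"
  note lu = last_rev_words23[OF assms(1)] and lv = last_rev_words23[OF assms(2)]
  \<comment> \<open>The Vandermonde identity merges the two kernels into the numerator of the
    connector.\<close>
  have du: "(\<Sum>m\<le>M. density ?N (rev u) m * of_nat ((M - m) choose p)) = (\<Sum>n\<le>M. harm (rev u) n * (of_nat (M choose (n + p)) / of_nat (M choose n)))" for p
  proof -
    have "(\<Sum>m\<le>M. density ?N (rev u) m * of_nat ((M - m) choose p))
        = (\<Sum>m\<le>M. \<Sum>n\<le>M. harm (rev u) n * (of_nat (choose_diff n m) * of_nat ((M - m) choose p)) / of_nat (M choose n))"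
      by (intro sum.cong refl) (simp add: density_eq_sum_harm[OF lu] sum_distrib_right mult.assoc)
    also have "\<dots> = (\<Sum>n\<le>M. harm (rev u) n * of_nat (\<Sum>m\<le>M. choose_diff n m * ((M - m) choose p)) / of_nat (M choose n))"
      by (subst sum.swap) (simp add: sum_distrib_left sum_divide_distrib)
    finally show ?thesis by (simp add: choose_diff_vandermonde)
  qed
  have "chain_sum ?N (u @ map swap_letter (rev v)) 1
      = (\<Sum>m\<le>M. density ?N (rev u) m * chain_sum ?N (map swap_letter (rev v)) (Suc m))"
    using chain_sum_append[OF assms(1) hd_map_swap_rev[OF assms(2)], of ?N] by (simp only: lessThan_Suc_atMost)
  also have "\<dots> = (\<Sum>m\<le>M. density ?N (rev u) m * (\<Sum>k\<le>M. harm (rev v) k * ?c k (M - m)))"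
    by (intro sum.cong refl, subst chain_sum_tau[OF assms(2)]) (auto simp: sum_density[OF lv])
  also have "\<dots> = (\<Sum>k\<le>M. harm (rev v) k / of_nat (M choose k) * (\<Sum>m\<le>M. density ?N (rev u) m * of_nat ((M - m) choose k)))"
    unfolding sum_distrib_left by (subst sum.swap) (simp add: mult_ac)
  also have "\<dots> = connected_sum M (rev v) (rev u)"
    unfolding du connected_sum_def sum_distrib_left conn_def by (simp add: mult_ac add.commute)
  finally show ?thesis unfolding connected_sum_commute[of M "rev v" "rev u"] .
qed

section \<open>Peeling the chains of a diamond value\<close>

definition chain_weight :: "nat \<Rightarrow> (nat list \<times> nat list) list \<Rightarrow> rat" where
  "chain_weight N c = (\<Prod>(ns, ms)\<leftarrow>c.
     1 / (\<Prod>n\<leftarrow>ns. of_nat N - of_nat n) * (1 / (\<Prod>m\<leftarrow>ms. of_nat m)))"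

text \<open>All entries of the first block are bounded, not just the first one: after peeling, its
  list of \<open>n\<close>-indices may be empty.\<close>

definition chains_from :: "(nat \<times> nat) list \<Rightarrow> nat \<Rightarrow> nat \<Rightarrow> (nat list \<times> nat list) list set" where
  "chains_from bs N k =
     {c \<in> diamond_chains bs N. c \<noteq> [] \<longrightarrow> (\<forall>n\<in>set (fst (hd c) @ snd (hd c)). k \<le> n)}"

definition word_of_blocks :: "(nat \<times> nat) list \<Rightarrow> letter list" where
  "word_of_blocks bs = concat (map (\<lambda>(a, b). replicate a Y @ replicate b X) bs)"

lemma diamond_chains_Nil: "diamond_chains [] N = {[]}"
  by (auto simp: diamond_chains_def)

lemma diamond_chains_Cons:
  "(ns, ms) # c \<in> diamond_chains ((a, b) # bs) N \<longleftrightarrow>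
     length ns = a \<and> length ms = b \<and> sorted (ns @ ms) \<and> set (ns @ ms) \<subseteq> {0<..<N}
     \<and> c \<in> diamond_chains bs N \<and> (c \<noteq> [] \<longrightarrow> last ms < hd (fst (hd c)))"
proof -
  have "(\<forall>i. Suc i < length (x # c) \<longrightarrow> P ((x # c) ! i) (c ! i)) \<longleftrightarrow>
      (\<forall>i. Suc i < length c \<longrightarrow> P (c ! i) (c ! Suc i)) \<and> (c \<noteq> [] \<longrightarrow> P x (hd c))"
    for x :: "nat list \<times> nat list" and P
    by (cases c) (auto simp: All_less_Suc2 less_Suc_eq_0_disj)
  from this[of "(ns, ms)" "\<lambda>x y. last (snd x) < hd (fst y)"]
  show ?thesis by (auto simp: diamond_chains_def)
qed

lemma diamond_chains_ConsE:
  assumes "c \<in> diamond_chains ((a, b) # bs) N"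
  obtains ns ms c' where "c = (ns, ms) # c'"
  using assms by (cases c) (auto simp: diamond_chains_def)

lemma finite_chains_from: "finite (chains_from bs N k)"
  by (rule finite_subset[OF _ finite_diamond_chains]) (auto simp: chains_from_def)

lemma chains_from_Cons:
  "c \<in> chains_from ((a, b) # bs) N k \<longleftrightarrow>
     (\<exists>ns ms c'. c = (ns, ms) # c' \<and> length ns = a \<and> length ms = b \<and> sorted (ns @ ms) \<and> set (ns @ ms) \<subseteq> {0<..<N} \<inter> {k..}
     \<and> c' \<in> diamond_chains bs N \<and> (c' \<noteq> [] \<longrightarrow> last ms < hd (fst (hd c'))))"
  (is "?L \<longleftrightarrow> ?R")
proof
  assume ?L
  then obtain ns ms c' where "c = (ns, ms) # c'"
    unfolding chains_from_def by (blast elim: diamond_chains_ConsE)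
  with \<open>?L\<close> show ?R by (auto simp: chains_from_def diamond_chains_Cons)
next
  assume ?R
  then show ?L by (auto simp: chains_from_def diamond_chains_Cons)
qed

text \<open>The pattern of the three peeling lemmas: \<open>m\<close> is the removed first entry,
  \<open>q m\<close> its factor in the weight.\<close>

lemma sum_peel:
  assumes "finite K" "\<And>m. finite (B m)" "bij_betw (\<lambda>(m, c). \<phi> m c) (Sigma K B) A"
    and "\<And>m c. m \<in> K \<Longrightarrow> c \<in> B m \<Longrightarrow> w (\<phi> m c) = q m * (w c :: rat)"
  shows "(\<Sum>c\<in>A. w c) = (\<Sum>m\<in>K. q m * (\<Sum>c\<in>B m. w c))"
proof -
  have "(\<Sum>c\<in>A. w c) = (\<Sum>(m, c)\<in>Sigma K B. w (\<phi> m c))"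
    by (subst sum.reindex_bij_betw[OF assms(3), symmetric]) (simp add: case_prod_unfold)
  also have "\<dots> = (\<Sum>m\<in>K. \<Sum>c\<in>B m. w (\<phi> m c))"
    using assms(1,2) by (subst sum.Sigma) auto
  finally show ?thesis using assms(4) by (simp add: sum_distrib_left)
qed

lemma peel_Y:
  assumes "k \<ge> 1"
  shows "(\<Sum>c\<in>chains_from ((Suc a, b) # bs) N k. chain_weight N c)
    = (\<Sum>m=k..<N. 1 / (of_nat N - of_nat m) * (\<Sum>c\<in>chains_from ((a, b) # bs) N m. chain_weight N c))"
proof (rule sum_peel[where \<phi> = "\<lambda>m c. (m # fst (hd c), snd (hd c)) # tl c"])
  show "bij_betw (\<lambda>(m, c). (m # fst (hd c), snd (hd c)) # tl c)
     (SIGMA m:{k..<N}. chains_from ((a, b) # bs) N m) (chains_from ((Suc a, b) # bs) N k)"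
  proof (rule bij_betwI[where g = "\<lambda>c. (hd (fst (hd c)), (tl (fst (hd c)), snd (hd c)) # tl c)"])
    show "(\<lambda>(m, c). (m # fst (hd c), snd (hd c)) # tl c) \<in>
       (SIGMA m:{k..<N}. chains_from ((a, b) # bs) N m) \<rightarrow> chains_from ((Suc a, b) # bs) N k"
      using assms by (fastforce simp: chains_from_Cons)
    show "(\<lambda>c. (hd (fst (hd c)), (tl (fst (hd c)), snd (hd c)) # tl c)) \<in>
       chains_from ((Suc a, b) # bs) N k \<rightarrow> (SIGMA m:{k..<N}. chains_from ((a, b) # bs) N m)"
      by (fastforce simp: chains_from_Cons length_Suc_conv)
  qed (auto simp: chains_from_Cons length_Suc_conv)
qed (auto simp: finite_chains_from chains_from_Cons chain_weight_def)

text \<open>Since \<open>b\<close> is positive, the removed entry is not the last of its block, so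
  the link to the next block is untouched and the new bound is weak.\<close>

lemma peel_X:
  assumes "k \<ge> 1" "b \<ge> 1"
  shows "(\<Sum>c\<in>chains_from ((0, Suc b) # bs) N k. chain_weight N c)
    = (\<Sum>m=k..<N. 1 / of_nat m * (\<Sum>c\<in>chains_from ((0, b) # bs) N m. chain_weight N c))"
proof (rule sum_peel[where \<phi> = "\<lambda>m c. ([], m # snd (hd c)) # tl c"])
  show "bij_betw (\<lambda>(m, c). ([], m # snd (hd c)) # tl c)
     (SIGMA m:{k..<N}. chains_from ((0, b) # bs) N m) (chains_from ((0, Suc b) # bs) N k)"
  proof (rule bij_betwI[where g = "\<lambda>c. (hd (snd (hd c)), ([], tl (snd (hd c))) # tl c)"])
    show "(\<lambda>(m, c). ([], m # snd (hd c)) # tl c) \<in>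
       (SIGMA m:{k..<N}. chains_from ((0, b) # bs) N m) \<rightarrow> chains_from ((0, Suc b) # bs) N k"
      using assms by (fastforce simp: chains_from_Cons)
    show "(\<lambda>c. (hd (snd (hd c)), ([], tl (snd (hd c))) # tl c)) \<in>
       chains_from ((0, Suc b) # bs) N k \<rightarrow> (SIGMA m:{k..<N}. chains_from ((0, b) # bs) N m)"
      using assms(2) by (fastforce simp: chains_from_Cons length_Suc_conv split: if_splits)
  qed (use assms(2) in \<open>auto simp: chains_from_Cons length_Suc_conv\<close>)
qed (auto simp: finite_chains_from chains_from_Cons chain_weight_def)

text \<open>In a positive block the list of \<open>n\<close>-indices is non-empty and the entries
  are sorted, so its head carries the bound.\<close>

lemma chains_from_eq:
  assumes "positive_blocks bs"
  shows "chains_from bs N k = {c \<in> diamond_chains bs N. c \<noteq> [] \<longrightarrow> k \<le> hd (fst (hd c))}"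
proof (cases bs)
  case Nil
  then show ?thesis by (auto simp: chains_from_def diamond_chains_Nil)
next
  case (Cons x bs')
  obtain a b where x: "x = (a, b)" by force
  with assms Cons have a: "a \<ge> 1" by (auto simp: positive_blocks_def)
  show ?thesis
  proof (intro set_eqI iffI)
    fix c assume c: "c \<in> chains_from bs N k"
    then obtain ns ms c' where "c = (ns, ms) # c'" "length ns = a" "\<forall>n\<in>set ns. k \<le> n"
      unfolding Cons x chains_from_Cons by force
    then show "c \<in> {c \<in> diamond_chains bs N. c \<noteq> [] \<longrightarrow> k \<le> hd (fst (hd c))}"
      using c a by (cases ns) (auto simp: chains_from_def)
  next
    fix c assume "c \<in> {c \<in> diamond_chains bs N. c \<noteq> [] \<longrightarrow> k \<le> hd (fst (hd c))}"
    then have c: "c \<in> diamond_chains bs N" "c \<noteq> [] \<longrightarrow> k \<le> hd (fst (hd c))" by auto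
    obtain ns ms c' where c': "c = (ns, ms) # c'"
      using c(1) unfolding Cons x by (rule diamond_chains_ConsE)
    have "length ns = a" "sorted (ns @ ms)"
      using c(1) unfolding Cons x c' diamond_chains_Cons by auto
    then have "\<forall>n\<in>set (ns @ ms). k \<le> n"
      using a c(2) c' by (cases ns) (auto dest: order_trans)
    then show "c \<in> chains_from bs N k"
      using c(1) by (simp add: chains_from_def c')
  qed
qed

text \<open>Removing the last entry of a block turns the strict link to the next block into the
  lower bound \<open>Suc m\<close>.\<close>

lemma peel_last_X:
  assumes "k \<ge> 1" "positive_blocks bs"
  shows "(\<Sum>c\<in>chains_from ((0, 1) # bs) N k. chain_weight N c)
    = (\<Sum>m=k..<N. 1 / of_nat m * (\<Sum>c\<in>chains_from bs N (Suc m). chain_weight N c))"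
proof (rule sum_peel[where \<phi> = "\<lambda>m c. ([], [m]) # c"])
  show "bij_betw (\<lambda>(m, c). ([], [m]) # c)
     (SIGMA m:{k..<N}. chains_from bs N (Suc m)) (chains_from ((0, 1) # bs) N k)"
  proof (rule bij_betwI[where g = "\<lambda>c. (hd (snd (hd c)), tl c)"])
    show "(\<lambda>(m, c). ([], [m]) # c) \<in>
       (SIGMA m:{k..<N}. chains_from bs N (Suc m)) \<rightarrow> chains_from ((0, 1) # bs) N k"
      using assms by (auto simp: chains_from_Cons chains_from_eq)
    show "(\<lambda>c. (hd (snd (hd c)), tl c)) \<in>
       chains_from ((0, 1) # bs) N k \<rightarrow> (SIGMA m:{k..<N}. chains_from bs N (Suc m))"
      using assms by (auto simp: chains_from_Cons chains_from_eq length_Suc_conv)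
  qed (auto simp: chains_from_Cons length_Suc_conv)
qed (auto simp: finite_chains_from chain_weight_def)

lemma hd_word_of_blocks: "positive_blocks bs \<Longrightarrow> word_of_blocks bs = [] \<or> hd (word_of_blocks bs) = Y"
  by (cases bs) (auto simp: word_of_blocks_def positive_blocks_def hd_append Suc_le_eq)

text \<open>Each peeling lemma mirrors one clause of \<open>chain_sum\<close>. Inductions on
  \<open>b\<close>, then on \<open>a\<close>, build up the first block from its right end.\<close>

lemma sum_chains_from:
  assumes "positive_blocks bs" "k \<ge> 1"
  shows "(\<Sum>c\<in>chains_from bs N k. chain_weight N c) = chain_sum N (word_of_blocks bs) k"
  using assms
proof (induction bs arbitrary: k)
  case Nil
  have "chains_from [] N k = {[]}" by (auto simp: chains_from_def diamond_chains_Nil)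
  then show ?case by (simp add: word_of_blocks_def chain_weight_def)
next
  case (Cons x bs)
  obtain a b where x: "x = (a, b)" by force
  have pos: "positive_blocks bs" "b \<ge> 1" using Cons.prems by (auto simp: positive_blocks_def x)
  have X: "(\<Sum>c\<in>chains_from ((0, b) # bs) N k. chain_weight N c) = chain_sum N (replicate b X @ word_of_blocks bs) k"
    if "k \<ge> 1" for k
    using pos(2) that
  proof (induction b arbitrary: k rule: dec_induct)
    case base
    then show ?case
      using Cons.IH[OF pos(1)] peel_last_X[OF base pos(1)] hd_word_of_blocks[OF pos(1)]
      by (simp add: chain_sum_X del: chain_sum.simps)
  next
    case (step b)
    \<comment> \<open>This selects the weak branch of \<open>chain_sum\<close>.\<close>
    then have "hd (replicate b X @ word_of_blocks bs) = X" by (cases b) auto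
    with step show ?case by (simp add: peel_X)
  qed
  have "(\<Sum>c\<in>chains_from ((a, b) # bs) N k. chain_weight N c)
      = chain_sum N (replicate a Y @ replicate b X @ word_of_blocks bs) k" if "k \<ge> 1" for k
    using that by (induction a arbitrary: k) (simp_all add: X peel_Y)
  then show ?case using Cons.prems by (simp add: x word_of_blocks_def)
qed

lemma word_of_index_of_blocks: "positive_blocks bs \<Longrightarrow> word_of_index (index_of_blocks bs) = word_of_blocks bs"
proof (induction bs)
  case (Cons x bs)
  obtain a b where x: "x = (Suc a, b)"
    using Cons.prems by (cases x; cases "fst x") (auto simp: positive_blocks_def)
  have "concat (map (\<lambda>k. Y # replicate (k - 1) X) (replicate n 1)) = replicate n Y" for n
    by (induction n) auto
  with Cons show ?case
    by (simp add: x index_of_blocks_def word_of_index_def word_of_blocks_def positive_blocks_def replicate_append_same)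
qed (simp add: word_of_index_def index_of_blocks_def word_of_blocks_def)

lemma admissible_index_of_blocks:
  assumes "positive_blocks bs" "bs \<noteq> []"
  shows "admissible (index_of_blocks bs)"
  using assms
proof (induction bs)
  case (Cons x bs)
  obtain a b where x: "x = (a, b)" by force
  have b: "b \<ge> 1" and pos: "positive_blocks bs"
    using Cons.prems by (auto simp: x positive_blocks_def)
  show ?case
  proof (cases "bs = []")
    case True
    then show ?thesis using b by (simp add: x admissible_def index_of_blocks_def)
  next
    case False
    then show ?thesis using Cons.IH pos by (auto simp: x admissible_def index_of_blocks_Cons)
  qed
qed simp

text \<open>Chain entries are positive, so the lower bound \<open>1\<close> admits every
  chain.\<close>

lemma Zdiamond_word_blocks:
  assumes "positive_blocks bs"
  shows "Zdiamond_word (word_of_blocks bs) N = chain_sum N (word_of_blocks bs) 1"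
proof (cases "bs = []")
  case True
  then show ?thesis by (simp add: word_of_blocks_def Zdiamond_word_def)
next
  case False
  note adm = admissible_index_of_blocks[OF assms False]
  have "chains_from bs N 1 = diamond_chains bs N"
  proof -
    obtain a b bs' where bs: "bs = (a, b) # bs'" using False by (cases bs) auto
    have "c \<in> chains_from bs N 1" if c: "c \<in> diamond_chains bs N" for c
    proof -
      obtain ns ms c' where "c = (ns, ms) # c'" using c unfolding bs by (rule diamond_chains_ConsE)
      then show ?thesis using c by (auto simp: bs chains_from_def diamond_chains_Cons Suc_le_eq)
    qed
    then show ?thesis by (auto simp: chains_from_def)
  qed
  then have "zeta_diamond (index_of_blocks bs) N = chain_sum N (word_of_blocks bs) 1"
    using sum_chains_from[OF assms, of 1 N]
    by (simp add: zeta_diamond_def blocks_index_of_blocks[OF assms] chain_weight_def[abs_def])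
  then show ?thesis
    using Zdiamond_index[OF adm] unfolding word_of_index_eq[symmetric] Zdiamond_word
    by (simp add: word_of_index_of_blocks[OF assms])
qed

section \<open>Comparison with the star product\<close>

text \<open>These are the monomials of \<open>H0\<close>: the empty word and the words that start
  with \<open>Y\<close> and end with \<open>X\<close>.\<close>

definition block_words :: "letter list set" where
  "block_words = word_of_blocks ` {bs. positive_blocks bs}"

lemma block_words_append: "u \<in> block_words \<Longrightarrow> v \<in> block_words \<Longrightarrow> u @ v \<in> block_words"
proof -
  assume "u \<in> block_words" "v \<in> block_words"
  then obtain bs cs where "positive_blocks bs" "positive_blocks cs" "u = word_of_blocks bs" "v = word_of_blocks cs"
    by (auto simp: block_words_def)
  then have "positive_blocks (bs @ cs)" "u @ v = word_of_blocks (bs @ cs)"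
    by (auto simp: positive_blocks_def word_of_blocks_def)
  then show "u @ v \<in> block_words" by (auto simp: block_words_def)
qed

lemma block_words_basic: "[] \<in> block_words" "[Y, X] \<in> block_words" "[Y, X, X] \<in> block_words" "[Y, Y, X] \<in> block_words"
proof -
  have "positive_blocks [] \<and> word_of_blocks [] = []"
    and "positive_blocks [(1, 1)] \<and> word_of_blocks [(1, 1)] = [Y, X]"
    and "positive_blocks [(1, 2)] \<and> word_of_blocks [(1, 2)] = [Y, X, X]"
    and "positive_blocks [(2, 1)] \<and> word_of_blocks [(2, 1)] = [Y, Y, X]"
    by (auto simp: positive_blocks_def word_of_blocks_def numeral_eq_Suc)
  then show "[] \<in> block_words" "[Y, X] \<in> block_words" "[Y, X, X] \<in> block_words" "[Y, Y, X] \<in> block_words"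
    unfolding block_words_def by (blast intro: image_eqI[OF sym])+
qed

lemma words23_block_words: "u \<in> words23 \<Longrightarrow> u \<in> block_words"
  by (induction rule: words23.induct) (auto intro: block_words_append block_words_basic)

lemma tau_words23_block_words: "u \<in> words23 \<Longrightarrow> map swap_letter (rev u) \<in> block_words"
  by (induction rule: words23.induct)
     (auto simp: block_words_basic dest: block_words_append[OF block_words_basic(2)] block_words_append[OF block_words_basic(4)])

lemma Zdiamond_word_tau:
  assumes "u \<in> words23" "v \<in> words23"
  shows "Zdiamond (word u * tau (word v)) (Suc M) = connected_sum M (rev u) (rev v)"
proof -
  have "u @ map swap_letter (rev v) \<in> block_words"
    using assms by (intro block_words_append words23_block_words tau_words23_block_words)
  then have "Zdiamond_word (u @ map swap_letter (rev v)) (Suc M) = chain_sum (Suc M) (u @ map swap_letter (rev v)) 1"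
    unfolding block_words_def using Zdiamond_word_blocks by auto
  then show ?thesis
    by (simp only: tau_word word_mult Zdiamond_word chain_sum_connected_sum[OF assms])
qed

text \<open>With an empty second word the connector is \<open>1\<close>, so the diamond value equals
  the harmonic sum over strictly increasing positive indices below \<open>N = Suc M\<close>.\<close>

lemma Zdiamond_words23: "u \<in> words23 \<Longrightarrow> Zdiamond (word u) (Suc M) = (\<Sum>n\<le>M. harm (rev u) n)"
  using Zdiamond_word_tau[OF _ words23.Nil, of u M] by (simp add: word_Nil tau_1 connected_sum_Nil)

lemma Zdiamond_diff: "Zdiamond (p - q) N = Zdiamond p N - Zdiamond q N"
  using Zdiamond_add[of "p - q" q N] by simp

lemma Zdiamond_0: "Zdiamond 0 N = 0"
  by (simp add: Zdiamond_def)

lemma H23_induct [consumes 1, case_names zero word diff]: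
  assumes "p \<in> H23" "P 0" "\<And>u. u \<in> words23 \<Longrightarrow> P (word u)" "\<And>p q. P p \<Longrightarrow> P q \<Longrightarrow> P (p - q)"
  shows "P p"
  using assms(1) unfolding H23_iff by (induction p rule: frag_induction) (use assms(2-) in auto)

section \<open>Increments in \<open>N\<close> of both sides\<close>

text \<open>On words the increment is the part of the harmonic sum with largest index
  \<open>Suc M\<close>; additivity extends this to \<open>H23\<close>.\<close>

lemma Zdiamond_mult_z2:
  assumes "p \<in> H23"
  shows "Zdiamond (p * gen_z 2) 1 = 0"
    and "Zdiamond (p * gen_z 2) (Suc (Suc M)) - Zdiamond (p * gen_z 2) (Suc M) = Zdiamond p (Suc M) / of_nat (Suc M) ^ 2"
proof -
  have "Zdiamond (p * gen_z 2) 1 = 0 \<and>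
    Zdiamond (p * gen_z 2) (Suc (Suc M)) - Zdiamond (p * gen_z 2) (Suc M) = Zdiamond p (Suc M) / of_nat (Suc M) ^ 2"
    using assms
  proof (induction rule: H23_induct)
    case (word u)
    have sum: "Zdiamond (word u * gen_z 2) (Suc K) = (\<Sum>n\<le>K. harm (X # Y # rev u) n)" for K
      using Zdiamond_words23[OF words23.snoc_z2[OF word]] by (simp add: word_snoc[symmetric] del: harm.simps)
    have "harm (X # Y # rev u) (Suc M) = (\<Sum>k\<le>M. harm (rev u) k) / of_nat (Suc M) ^ 2"
      by (simp add: lessThan_Suc_atMost power2_eq_square del: of_nat_Suc)
    then show ?case
      by (simp add: sum sum[of 0, simplified] Zdiamond_words23[OF word] del: harm.simps of_nat_Suc)
        (simp add: harm_0)
  qed (simp_all add: Zdiamond_0 Zdiamond_diff left_diff_distrib diff_divide_distrib)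
  then show "Zdiamond (p * gen_z 2) 1 = 0"
    and "Zdiamond (p * gen_z 2) (Suc (Suc M)) - Zdiamond (p * gen_z 2) (Suc M) = Zdiamond p (Suc M) / of_nat (Suc M) ^ 2"
    by auto
qed

lemma Zdiamond_mult_z3:
  assumes "p \<in> H23"
  shows "Zdiamond (p * gen_z 3) 1 = 0"
    and "Zdiamond (p * gen_z 3) (Suc (Suc M)) - Zdiamond (p * gen_z 3) (Suc M) = Zdiamond p (Suc M) / of_nat (Suc M) ^ 3"
proof -
  have "Zdiamond (p * gen_z 3) 1 = 0 \<and>
    Zdiamond (p * gen_z 3) (Suc (Suc M)) - Zdiamond (p * gen_z 3) (Suc M) = Zdiamond p (Suc M) / of_nat (Suc M) ^ 3"
    using assms
  proof (induction rule: H23_induct)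
    case (word u)
    have sum: "Zdiamond (word u * gen_z 3) (Suc K) = (\<Sum>n\<le>K. harm (X # X # Y # rev u) n)" for K
      using Zdiamond_words23[OF words23.snoc_z3[OF word]] by (simp add: word_snoc[symmetric] del: harm.simps)
    have "harm (X # X # Y # rev u) (Suc M) = (\<Sum>k\<le>M. harm (rev u) k) / of_nat (Suc M) ^ 3"
      by (simp add: lessThan_Suc_atMost power3_eq_cube del: of_nat_Suc)
    then show ?case
      by (simp add: sum sum[of 0, simplified] Zdiamond_words23[OF word] del: harm.simps of_nat_Suc)
        (simp add: harm_0)
  qed (simp_all add: Zdiamond_0 Zdiamond_diff left_diff_distrib diff_divide_distrib)
  then show "Zdiamond (p * gen_z 3) 1 = 0"
    and "Zdiamond (p * gen_z 3) (Suc (Suc M)) - Zdiamond (p * gen_z 3) (Suc M) = Zdiamond p (Suc M) / of_nat (Suc M) ^ 3"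
    by auto
qed

text \<open>Induction on total length, and for a common last factor on \<open>M\<close>: both sides
  are \<open>0\<close> at \<open>N = 1\<close>, and the recursion of the star product matches that
  of connected sums increment by increment.\<close>

lemma Zdiamond_star_words23:
  assumes "u \<in> words23" "v \<in> words23"
  shows "Zdiamond (word u \<star> word v) (Suc M) = connected_sum M (rev u) (rev v)"
  using assms
proof (induction "length u + length v" arbitrary: u v M rule: less_induct)
  case less
  have z2: "Zdiamond ((word u' \<star> word v') * gen_z 2) (Suc M) = connected_sum M (X # Y # rev u') (rev v')"
    if uv: "u' \<in> words23" "v' \<in> words23" "length u' + length v' < length u + length v" for u' v' M
  proof -
    have H: "word u' \<star> word v' \<in> H23" using uv by (intro star_word_in_H23)
    show ?thesis
    proof (induction M)
      case 0
      show ?case using Zdiamond_mult_z2(1)[OF H] by (simp add: connected_sum_0)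
    next
      case (Suc M)
      have "Zdiamond ((word u' \<star> word v') * gen_z 2) (Suc (Suc M)) - Zdiamond ((word u' \<star> word v') * gen_z 2) (Suc M)
          = connected_sum (Suc M) (X # Y # rev u') (rev v') - connected_sum M (X # Y # rev u') (rev v')"
        by (simp only: Zdiamond_mult_z2(2)[OF H] connected_sum_z2 less(1)[OF uv(3,1,2)])
      then show ?case using Suc by simp
    qed
  qed
  from less.prems(1) show ?case
  proof cases
    case Nil
    then show ?thesis
      using less.prems(2)
      by (simp add: word_Nil star_1_left Zdiamond_words23 connected_sum_commute[of M "[]"] connected_sum_Nil)
  next
    case (snoc_z2 u')
    then show ?thesis using z2[of u' v] less.prems by (simp add: word_snoc star_z2_left)
  next
    case u: (snoc_z3 u')
    from less.prems(2) show ?thesis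
    proof cases
      case Nil
      then show ?thesis
        using less.prems(1) by (simp add: word_Nil star_1_right Zdiamond_words23 connected_sum_Nil)
    next
      case (snoc_z2 v')
      then show ?thesis
        using z2[of u v'] less.prems
        by (simp add: word_snoc star_z2_right connected_sum_z2_swap)
    next
      case v: (snoc_z3 v')
      define p q r where "p = word u' \<star> word v" and "q = word u \<star> word v'" and "r = (word u' \<star> word v') * gen_z 2"
      have star: "word u \<star> word v = p * gen_z 3 + q * gen_z 3 + r * gen_z 2 * gen_z 2"
        unfolding p_def q_def r_def using star_z3_z3[of u' v']
        by (simp add: u v word_snoc power3_eq_cube mult.assoc)
      \<comment> \<open>Two of the three factors \<open>z_2\<close> are absorbed into the arguments.
        The resulting words are shorter than \<open>u\<close> and \<open>v\<close>, so the induction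
        hypothesis applies to them.\<close>
      have r: "r * gen_z 2 = word (u' @ [Y, X]) \<star> word (v' @ [Y, X])"
        using u v star_z2_right[OF words23.snoc_z2, of u' v'] by (simp add: r_def word_snoc star_z2_left)
      have H: "p \<in> H23" "q \<in> H23" "r * gen_z 2 \<in> H23"
        unfolding p_def q_def r
        using less.prems u v by (auto intro!: star_word_in_H23 words23.snoc_z2)
      show ?thesis
      proof (induction M)
        case 0
        have "Zdiamond (word u \<star> word v) 1 = 0"
          unfolding star Zdiamond_add H(1,2)[THEN Zdiamond_mult_z3(1)] Zdiamond_mult_z2(1)[OF H(3)] by simp
        then show ?case by (simp add: connected_sum_0 u)
      next
        case (Suc M)
        have vals: "Zdiamond p (Suc M) = connected_sum M (rev u') (rev v)"
          "Zdiamond q (Suc M) = connected_sum M (rev u) (rev v')"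
          "Zdiamond (r * gen_z 2) (Suc M) = connected_sum M (X # Y # rev u') (X # Y # rev v')"
          unfolding p_def q_def r
          using less(1)[of u' v M] less(1)[of u v' M] less(1)[of "u' @ [Y, X]" "v' @ [Y, X]" M] less.prems u v
          by (simp_all add: words23.snoc_z2)
        have "Zdiamond (word u \<star> word v) (Suc (Suc M)) - Zdiamond (word u \<star> word v) (Suc M)
            = Zdiamond p (Suc M) / of_nat (Suc M) ^ 3 + Zdiamond q (Suc M) / of_nat (Suc M) ^ 3
              + Zdiamond (r * gen_z 2) (Suc M) / of_nat (Suc M) ^ 2"
          unfolding H(1,2)[THEN Zdiamond_mult_z3(2), symmetric] H(3)[THEN Zdiamond_mult_z2(2), symmetric]
          unfolding star Zdiamond_add by (simp only: add_diff_add)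
        also have "\<dots> = connected_sum (Suc M) (rev u) (rev v) - connected_sum M (rev u) (rev v)"
          using connected_sum_z3_z3[of M "rev u'" "rev v'"]
          unfolding vals by (simp add: u v add_divide_distrib del: of_nat_Suc)
        finally show ?case using Suc by simp
      qed
    qed
  qed
qed

theorem corollary1p4:
  fixes w1 w2 :: ncpoly and N :: nat
  assumes "w1 \<in> H23" and "w2 \<in> H23" and "N > 0"
  shows "Zdiamond (w1 * tau w2) N = Zdiamond (w1 \<star> w2) N"
proof -
  obtain M where N: "N = Suc M" using assms(3) by (cases N) auto
  \<comment> \<open>Both sides are additive in each argument, which reduces the claim to
    words.\<close>
  have *: "Zdiamond (word u * tau w2) N = Zdiamond (word u \<star> w2) N" if "u \<in> words23" for u
    using assms(2)
  proof (induction rule: H23_induct)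
    case (word v)
    then show ?case using that by (simp add: N Zdiamond_word_tau Zdiamond_star_words23)
  qed (simp_all add: Zdiamond_0 Zdiamond_diff tau_0 tau_diff star_0_right star_diff_right right_diff_distrib)
  show ?thesis
    using assms(1)
    by (induction rule: H23_induct)
       (simp_all add: * Zdiamond_0 Zdiamond_diff star_0_left star_diff_left left_diff_distrib)
qed

end
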